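(* Let $g:[0,1]\to\mathbb{R}$ be continuous with $g(0)=0$. (a) Let $n\ge1$ and suppose $\mu$ is a signed Borel measure on $\overline{\mathbb{B}^n}$ satisfying $0<\mu(\overline{\mathbb{B}^n})\le|\mu|(\overline{\mathbb{B}^n})<\infty$. If $g(1)>0$ and $\mu(\{y\})<\frac12\mu(\overline{\mathbb{B}^n})$ for all $y\in\partial\mathbb{B}^n$, then $V(x)=0$ for some $x\in\mathbb{B}^n$, where $V(x)=\int_{\overline{\mathbb{B}^n}}v(T_x(y))\,d\mu(y)$. (b) Let $n\ge2$ and suppose $\mu$ is a signed Borel measure on $S^{n-1}$ satisfying $0<\mu(S^{n-1})\le|\mu|(S^{n-1})<\infty$. If $\mu(\{y\})<\frac12\mu(S^{n-1})$ for all $y\in S^{n-1}$, then $\int_{S^{n-1}}T_x(y)\,d\mu(y)=0$ for some $x\in\mathbb{B}^n$. Equivalently, pushing forward the signed measure by $T_x$ yields a measure whose center of mass lies at the origin: $\int_{S^{n-1}}y\,d[(T_x)_*\mu](y)=0$. (c) Let $n\ge2$. If $f:S^{n-1}\to\mathbb{R}$ is integrable and $\int_{S^{n-1}}f\,dS\neq0$, then a point $x\in\mathbb{B}^n$ exists such that each component of $T_x$ is orthogonal to $f$, meaning $\int_{S^{n-1}}T_x(y)f(y)\,dS(y)=0$. (d) If $f$ is real-valued and integrable on a simply connected planar domain $\Omega\subset\mathbb{C}$ with $\int_\Omega f(z)\,|dz|^2\neq0$, and $F:\Omega\to\mathbb{D}$ is continuous and $g(1)>0$, then a point $w\in\mathbb{D}$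 exists such that $\nu\circ T_w\circ F$ is orthogonal to $f$, meaning $\int_\Omega\nu\big(T_w(F(z))\big)f(z)\,|dz|^2=0$. (e) If $f$ is real-valued and integrable on a rectifiable Jordan curve $J\subset\mathbb{C}$ with $\int_J f\,|dz|\neq0$, and $F:J\to\partial\mathbb{D}$ is a homeomorphism, then a point $w\in\mathbb{D}$ exists such that $T_w\circ F$ is orthogonal to $f$, meaning $\int_J T_w(F(z))f(z)\,|dz|=0$.
   Context: $\mathbb{B}^n$ is the open unit ball centered at the origin in $\mathbb{R}^n$, $\overline{\mathbb{B}^n}$ its closure, $S^{n-1}=\partial\mathbb{B}^n$ the unit sphere, $dS$ surface area measure, and $|\cdot|$ the euclidean norm. For $x\in\mathbb{B}^n$ the M\"obius transformation $T_x:\overline{\mathbb{B}^n}\to\overline{\mathbb{B}^n}$ is $$T_x(y)=\frac{(1+2x\cdot y+|y|^2)x+(1-|x|^2)y}{1+2x\cdot y+|x|^2|y|^2},\qquad y\in\overline{\mathbb{B}^n}.$$ The radial vector field $v:\overline{\mathbb{B}^n}\to\mathbb{R}^n$ is $v(y)=g(|y|)\,y/|y|$ for $y\neq0$ and $v(0)=0$. For a signed measure $\mu$, $|\mu|$ denotes its total variation measure; $(T_x)_*\mu$ is the pushforward. In the plane, $\mathbb{D}$ is the open unit disk in $\mathbb{C}$, and the M\"obius transformation is written in complex notation as $T_w(z)=\dfrac{z+w}{1+z\overline{w}}$ for $w\in\mathbb{D}$, $z\in\overline{\mathbb{D}}$. The function $\nu:\overline{\mathbb{D}}\to\mathbb{C}$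 is $\nu(re^{i\theta})=g(r)e^{i\theta}$ (so $\nu(0)=0$). $|dz|^2$ denotes area measure on the plane and $|dz|$ arclength measure on $J$. *)

theory Defs
  imports "HOL-Analysis.Analysis"
begin

text \<open>
  Signed measures are extended-real set functions on the \<open>\<sigma>\<close>-algebra of a measure space \<open>M\<close>;
  only \<open>space M\<close> and \<open>sets M\<close> are used, and values outside \<open>sets M\<close> are irrelevant.
\<close>

definition signed_measure :: "'a measure \<Rightarrow> ('a set \<Rightarrow> ereal) \<Rightarrow> bool" where
  "signed_measure M \<mu> \<longleftrightarrow>
     \<mu> {} = 0 \<and>
     ((\<forall>A\<in>sets M. \<mu> A \<noteq> \<infinity>) \<or> (\<forall>A\<in>sets M. \<mu> A \<noteq> -\<infinity>)) \<and>
     (\<forall>A :: nat \<Rightarrow> 'a set. range A \<subseteq> sets M \<longrightarrow> disjoint_family A \<longrightarrow>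
        (\<lambda>i. \<mu> (A i)) sums \<mu> (\<Union>i. A i))"

definition total_variation :: "'a measure \<Rightarrow> ('a set \<Rightarrow> ereal) \<Rightarrow> 'a set \<Rightarrow> ereal" where
  "total_variation M \<mu> A =
     (SUP P \<in> {P :: nat \<Rightarrow> 'a set. range P \<subseteq> sets M \<and> disjoint_family P \<and> (\<Union>i. P i) = A}.
        (\<Sum>i. \<bar>\<mu> (P i)\<bar>))"

text \<open>
  The positive part of the Jordan decomposition, \<open>\<mu>\<^sup>+(A) = sup {\<mu>(B) | B \<subseteq> A}\<close>.  The supremum
  is nonnegative because \<open>B = {}\<close> is admitted, so the truncation in \<open>e2ennreal\<close> is harmless.
  The negative part of \<open>\<mu>\<close> is the positive part of \<open>-\<mu>\<close>.
\<close>

definition positive_part :: "'a measure \<Rightarrow> ('a set \<Rightarrow> ereal) \<Rightarrow> 'a measure" where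
  "positive_part M \<mu> =
     measure_of (space M) (sets M) (\<lambda>A. SUP B \<in> {B \<in> sets M. B \<subseteq> A}. e2ennreal (\<mu> B))"

definition negative_part :: "'a measure \<Rightarrow> ('a set \<Rightarrow> ereal) \<Rightarrow> 'a measure" where
  "negative_part M \<mu> = positive_part M (\<lambda>A. - \<mu> A)"

definition signed_integral ::
  "'a measure \<Rightarrow> ('a set \<Rightarrow> ereal) \<Rightarrow> ('a \<Rightarrow> 'b) \<Rightarrow> 'b::{banach, second_countable_topology}" where
  "signed_integral M \<mu> f =
     (LINT x|positive_part M \<mu>. f x) - (LINT x|negative_part M \<mu>. f x)"

definition signed_pushforward ::
  "'a measure \<Rightarrow> ('a \<Rightarrow> 'b) \<Rightarrow> ('a set \<Rightarrow> ereal) \<Rightarrow> 'b set \<Rightarrow> ereal" where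
  "signed_pushforward M h \<mu> A = \<mu> (h -` A \<inter> space M)"

definition mobius :: "'a::euclidean_space \<Rightarrow> 'a \<Rightarrow> 'a" where
  "mobius x y =
     ((1 + 2 * (x \<bullet> y) + (norm y)\<^sup>2) *\<^sub>R x + (1 - (norm x)\<^sup>2) *\<^sub>R y)
       /\<^sub>R (1 + 2 * (x \<bullet> y) + (norm x)\<^sup>2 * (norm y)\<^sup>2)"

definition radial_field :: "(real \<Rightarrow> real) \<Rightarrow> 'a::euclidean_space \<Rightarrow> 'a" where
  "radial_field g y = (if y = 0 then 0 else g (norm y) *\<^sub>R (y /\<^sub>R norm y))"

definition complex_mobius :: "complex \<Rightarrow> complex \<Rightarrow> complex" where
  "complex_mobius w z = (z + w) / (1 + z * cnj w)"

text \<open>Since \<open>Arg 0 = 0\<close>, this gives \<open>nu g 0 = of_real (g 0)\<close>, which is \<open>0\<close> when \<open>g 0 = 0\<close>.\<close>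

definition nu :: "(real \<Rightarrow> real) \<Rightarrow> complex \<Rightarrow> complex" where
  "nu g z = of_real (g (cmod z)) * cis (Arg z)"

text \<open>
  Surface area on the unit sphere of an \<open>n\<close>-dimensional space, as in integration in polar
  coordinates: the area of \<open>A\<close> is \<open>n\<close> times the volume of the cone \<open>{t y | 0 < t < 1, y \<in> A}\<close>.
  The measure is completed, so that \<open>integrable\<close> does not demand Borel measurability.
\<close>

definition sphere_measure :: "'a::euclidean_space measure" where
  "sphere_measure =
     completion (scale_measure (of_nat DIM('a))
       (distr (restrict_space lborel (ball 0 1 - {0})) (restrict_space borel (sphere 0 1))
          (\<lambda>x. x /\<^sub>R norm x)))"

text \<open>
  Length of the arc of \<open>\<gamma>\<close> over \<open>[a,b]\<close>: supremum of the lengths of the inscribed polygons with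
  vertices \<open>\<gamma> (t 0), \<dots>, \<gamma> (t k)\<close>.  It is \<open>0\<close> if \<open>b < a\<close>.
\<close>

definition curve_length :: "(real \<Rightarrow> 'a::metric_space) \<Rightarrow> real \<Rightarrow> real \<Rightarrow> ennreal" where
  "curve_length \<gamma> a b =
     (SUP (k, t) \<in> {(k :: nat, t :: nat \<Rightarrow> real). mono_on {..k} t \<and> t ` {..k} \<subseteq> {a..b}}.
        \<Sum>i<k. ennreal (dist (\<gamma> (t i)) (\<gamma> (t (Suc i)))))"

definition rectifiable_jordan :: "(real \<Rightarrow> complex) \<Rightarrow> bool" where
  "rectifiable_jordan \<gamma> \<longleftrightarrow>
     simple_path \<gamma> \<and> pathfinish \<gamma> = pathstart \<gamma> \<and> curve_length \<gamma> 0 1 < \<infinity>"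

text \<open>
  Arclength on the trace of a simple rectifiable curve \<open>\<gamma>\<close>: the push-forward under \<open>\<gamma>\<close> of the
  Stieltjes measure of the function \<open>s \<mapsto> length of \<gamma> on [0,s]\<close>, so that the measure of an arc is
  its length; completed like \<open>sphere_measure\<close>.
\<close>

definition arclength_measure :: "(real \<Rightarrow> complex) \<Rightarrow> complex measure" where
  "arclength_measure \<gamma> =
     completion (distr
       (restrict_space (interval_measure (\<lambda>s. enn2real (curve_length \<gamma> 0 (min s 1)))) {0..1})
       (restrict_space borel (path_image \<gamma>)) \<gamma>)"

end

theory Submission
  imports Defs
begin

text \<open>
  \<open>V\<close> is continuous on the open ball.  If \<open>x\<close> tends to a boundary point \<open>p\<close>, then \<open>T\<^sub>x(y)\<close> tends to
  \<open>p\<close> for every \<open>y \<noteq> - p\<close>, so that \<open>V(x) \<bullet> x\<close> is asymptotically at least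
  \<open>g(1) (\<mu>(B) - a - \<bar>a\<bar>)\<close> with \<open>B\<close> the closed ball and \<open>a = \<mu>({- p})\<close>, which is positive by
  the hypothesis on point masses.  Thus \<open>V\<close> points outward on spheres of radius near \<open>1\<close>, and
  Brouwer's theorem yields a zero.  Every part of the theorem is an instance of this for the
  difference of two finite measures, pushed into the ball by a map.  In the last part the
  measure has no atoms because the length of a rectifiable arc depends continuously on its end.
\<close>

subsection \<open>Moebius transformations of the closed ball\<close>

text \<open>Dominated convergence works with nonnegative measures, so the boundary behaviour is
  found for one such measure at a time and the two limits are subtracted afterwards. The atom at
  \<open>- p\<close> is kept as a separate term because \<open>mobius x (- p)\<close> need not
  converge as \<open>x\<close> tends to \<open>p\<close>: it stays on the sphere, but its position
  depends on how \<open>p\<close> is approached. Only the length \<open>g 1\<close> of its field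
  vector can be used, which costs \<open>\<bar>a\<bar> * g 1\<close>. With total mass
  \<open>m\<close>, the quantity \<open>m - a - \<bar>a\<bar>\<close> is \<open>m - 2 * a\<close>
  for \<open>a \<ge> 0\<close>, positive by the half-mass hypothesis, and it is \<open>m\<close> for
  \<open>a < 0\<close>; hence negative atoms may have any size. Each measure stays on its own space
  and reaches the ball through a map \<open>\<Phi>\<close>, so that densities on a domain or a curve
  are treated without pushing forward signed measures. Jordan parts do not commute with push-forward
  along a general map, so the equivalence in the spherical case rests on an explicit Borel inverse
  of \<open>mobius x\<close> on the sphere.\<close>

lemma mobius_denom_pos:
  fixes x y :: "'a::euclidean_space"
  assumes "norm x < 1" "norm y \<le> 1"
  shows "0 < 1 + 2 * (x \<bullet> y) + (norm x)\<^sup>2 * (norm y)\<^sup>2"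
proof -
  have "norm x * norm y < 1"
    using assms mult_left_le[of "norm y" "norm x"] by auto
  then have "0 < (1 - norm x * norm y)\<^sup>2"
    by simp
  also have "\<dots> = 1 - 2 * (norm x * norm y) + (norm x)\<^sup>2 * (norm y)\<^sup>2"
    by (simp add: power2_eq_square algebra_simps)
  also have "\<dots> \<le> 1 + 2 * (x \<bullet> y) + (norm x)\<^sup>2 * (norm y)\<^sup>2"
    using Cauchy_Schwarz_ineq2[of x y] by linarith
  finally show ?thesis .
qed

text \<open>The squared denominator minus the squared norm of the numerator is a multiple of
  \<open>D\<close>, so one power of \<open>D\<close> cancels. The sign of the right-hand side makes
  \<open>mobius x\<close> preserve the closed ball, and its vanishing for \<open>norm y = 1\<close>
  makes it preserve the sphere.\<close>

lemma one_minus_norm_mobius: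
  fixes x y :: "'a::euclidean_space"
  defines "D \<equiv> 1 + 2 * (x \<bullet> y) + (norm x)\<^sup>2 * (norm y)\<^sup>2"
  assumes "D \<noteq> 0"
  shows "1 - (norm (mobius x y))\<^sup>2 = (1 - (norm x)\<^sup>2) * (1 - (norm y)\<^sup>2) / D"
proof -
  let ?a = "1 + 2 * (x \<bullet> y) + (norm y)\<^sup>2" and ?b = "1 - (norm x)\<^sup>2"
  let ?v = "?a *\<^sub>R x + ?b *\<^sub>R y"
  have "?v \<bullet> ?v = ?a\<^sup>2 * (norm x)\<^sup>2 + 2 * ?a * ?b * (x \<bullet> y) + ?b\<^sup>2 * (norm y)\<^sup>2"
    by (simp add: inner_add_left inner_add_right inner_commute[of y x] power2_norm_eq_inner)
       (simp add: power2_eq_square algebra_simps)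
  then have "D\<^sup>2 - ?v \<bullet> ?v = (1 - (norm x)\<^sup>2) * (1 - (norm y)\<^sup>2) * D"
    unfolding D_def by (simp add: power2_eq_square algebra_simps)
  moreover have "(norm (mobius x y))\<^sup>2 = ?v \<bullet> ?v / D\<^sup>2"
    unfolding mobius_def D_def[symmetric]
    unfolding norm_scaleR power_mult_distrib by (simp add: power2_norm_eq_inner[of ?v] power_divide divide_inverse power_inverse)
  ultimately have "1 - (norm (mobius x y))\<^sup>2 = (1 - (norm x)\<^sup>2) * (1 - (norm y)\<^sup>2) * D / D\<^sup>2"
    using \<open>D \<noteq> 0\<close> by (metis diff_divide_distrib divide_self power_not_zero)
  then show ?thesis
    using \<open>D \<noteq> 0\<close> by (simp add: power2_eq_square)
qed

lemma mobius_in_cball: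
  fixes x y :: "'a::euclidean_space"
  assumes "x \<in> ball 0 1" "y \<in> cball 0 1"
  shows "mobius x y \<in> cball 0 1"
proof -
  have n: "norm x < 1" "norm y \<le> 1" using assms by auto
  note D = mobius_denom_pos[OF n]
  have "0 \<le> (1 - (norm x)\<^sup>2) * (1 - (norm y)\<^sup>2)"
    using n by (intro mult_nonneg_nonneg) (auto simp: power_le_one)
  then have "(norm (mobius x y))\<^sup>2 \<le> 1"
    using one_minus_norm_mobius[of x y] D by (smt (verit) divide_nonneg_pos)
  then show ?thesis by (simp add: power2_le_iff_abs_le abs_square_le_1)
qed

lemma mobius_in_sphere:
  fixes x y :: "'a::euclidean_space"
  assumes "x \<in> ball 0 1" "y \<in> sphere 0 1"
  shows "mobius x y \<in> sphere 0 1"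
proof -
  have "1 - (norm (mobius x y))\<^sup>2 = 0"
    using one_minus_norm_mobius[of x y] mobius_denom_pos[of x y] assms by auto
  then have "(norm (mobius x y))\<^sup>2 = 1" by simp
  then show ?thesis by (simp add: abs_square_eq_1)
qed

text \<open>On the sphere, \<open>T\<^sub>x\<close> is an affine image of the inversion applied to \<open>x + y\<close>,
  which makes its inverse explicit.\<close>

lemma mobius_sphere_eq:
  fixes x y :: "'a::euclidean_space"
  assumes "x \<in> ball 0 1" "y \<in> sphere 0 1"
  shows "mobius x y = x + ((1 - (norm x)\<^sup>2) / (norm (x + y))\<^sup>2) *\<^sub>R (x + y)"
proof -
  have y: "norm y = 1" using assms by auto
  have D: "(norm (x + y))\<^sup>2 = 1 + 2 * (x \<bullet> y) + (norm x)\<^sup>2"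
    using y dot_norm[of x y] by (simp add: field_simps)
  have pos: "0 < 1 + 2 * (x \<bullet> y) + (norm x)\<^sup>2"
    using mobius_denom_pos[of x y] assms by auto
  let ?D = "1 + 2 * (x \<bullet> y) + (norm x)\<^sup>2"
  have "(1 + 2 * (x \<bullet> y) + 1) *\<^sub>R x + (1 - (norm x)\<^sup>2) *\<^sub>R y
     = ?D *\<^sub>R x + (1 - (norm x)\<^sup>2) *\<^sub>R (x + y)"
    by (simp add: algebra_simps scaleR_2)
  then have "mobius x y = (?D *\<^sub>R x + (1 - (norm x)\<^sup>2) *\<^sub>R (x + y)) /\<^sub>R ?D"
    by (simp add: mobius_def y)
  also have "\<dots> = x + ((1 - (norm x)\<^sup>2) / ?D) *\<^sub>R (x + y)"
    using pos by (simp add: scaleR_add_right divide_inverse mult.commute)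
  finally show ?thesis by (simp add: D)
qed

text \<open>On the sphere this is \<open>mobius (- x)\<close>. For \<open>u = x + y\<close> and
  \<open>c = 1 - (norm x)\<^sup>2\<close>, the vector \<open>mobius x y - x\<close> is the image of
  \<open>u\<close> under inversion in the sphere of squared radius \<open>c\<close> about the
  origin; inversion is an involution, so a second application returns \<open>u\<close>.\<close>

definition mobius_sphere_inv :: "'a::euclidean_space \<Rightarrow> 'a \<Rightarrow> 'a" where
  "mobius_sphere_inv x z = ((1 - (norm x)\<^sup>2) / (norm (z - x))\<^sup>2) *\<^sub>R (z - x) - x"

lemma mobius_sphere_inv:
  fixes x y :: "'a::euclidean_space"
  assumes "x \<in> ball 0 1" "y \<in> sphere 0 1"
  shows "mobius_sphere_inv x (mobius x y) = y"
proof -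
  define c where "c = 1 - (norm x)\<^sup>2"
  define u where "u = x + y"
  have c: "c > 0" using assms by (simp add: c_def power_less_one_iff)
  have "u \<noteq> 0"
  proof
    assume "u = 0"
    then have "x = - y" by (simp add: u_def eq_neg_iff_add_eq_0)
    then show False using assms by simp
  qed
  have "mobius x y - x = (c / (norm u)\<^sup>2) *\<^sub>R u"
    using mobius_sphere_eq[OF assms] by (simp add: c_def u_def)
  moreover from this have "norm (mobius x y - x) = c / norm u"
    using c \<open>u \<noteq> 0\<close> by (simp add: power2_eq_square)
  ultimately have "mobius_sphere_inv x (mobius x y) = u - x"
    unfolding mobius_sphere_inv_def c_def[symmetric]
    using c \<open>u \<noteq> 0\<close> by (simp add: power_divide power2_eq_square)
  then show ?thesis by (simp add: u_def)
qed

lemma measurable_mobius_sphere_inv [measurable]: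
  "mobius_sphere_inv x \<in> borel_measurable borel"
  unfolding mobius_sphere_inv_def by measurable

lemma measurable_mobius [measurable]:
  "mobius x \<in> borel_measurable borel"
  unfolding mobius_def by measurable

text \<open>The condition is put on the denominator because the limit is taken both at interior
  points \<open>x\<close> and at boundary points, where the denominator is nonzero exactly off the
  antipode.\<close>

lemma tendsto_mobius:
  fixes x y :: "'a::euclidean_space"
  assumes "(X \<longlongrightarrow> x) F" "1 + 2 * (x \<bullet> y) + (norm x)\<^sup>2 * (norm y)\<^sup>2 \<noteq> 0"
  shows "((\<lambda>k. mobius (X k) y) \<longlongrightarrow> mobius x y) F"
  unfolding mobius_def using assms by (auto intro!: tendsto_intros)

lemma mobius_denom_boundary:
  fixes x y :: "'a::euclidean_space"
  assumes "x \<in> sphere 0 1"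
  shows "1 + 2 * (x \<bullet> y) + (norm x)\<^sup>2 * (norm y)\<^sup>2 = (norm (x + y))\<^sup>2"
  using assms dot_norm[of x y] by (simp add: field_simps)

text \<open>For \<open>norm x = 1\<close> the coefficient of \<open>y\<close> vanishes and that of
  \<open>x\<close> coincides with the denominator, so the formula, read beyond the open ball,
  collapses to a constant. At \<open>y = - x\<close> numerator and denominator both vanish.\<close>

lemma mobius_boundary:
  fixes x y :: "'a::euclidean_space"
  assumes "x \<in> sphere 0 1" "y \<noteq> - x"
  shows "mobius x y = x"
proof -
  have "x + y \<noteq> 0" using assms by (metis add_eq_0_iff)
  then have "1 + 2 * (x \<bullet> y) + (norm y)\<^sup>2 \<noteq> 0"
    using mobius_denom_boundary[OF assms(1), of y] assms(1) by auto
  then show ?thesis using assms(1) by (simp add: mobius_def)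
qed

section \<open>Continuity and measurability of the radial field\<close>

lemma continuous_on_radial_field:
  fixes g :: "real \<Rightarrow> real"
  assumes g: "continuous_on {0..1} g" "g 0 = 0"
  shows "continuous_on (cball 0 1 :: 'a::euclidean_space set) (radial_field g)"
  unfolding continuous_on_eq_continuous_within
proof
  fix y :: 'a assume y: "y \<in> cball 0 1"
  have gn: "continuous_on (cball 0 1 :: 'a set) (\<lambda>y. g (norm y))"
    by (rule continuous_on_compose2[OF g(1)]) (auto intro!: continuous_on_norm_id)
  show "continuous (at y within cball 0 1) (radial_field g)"
  proof (cases "y = 0")
    case True
    \<comment> \<open>The direction of \<open>z\<close> has no limit at the origin; the field is
      continuous there because its length \<open>\<bar>g (norm z)\<bar>\<close> tends to 0 by
      \<open>g 0 = 0\<close>.\<close>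
    have "((\<lambda>z::'a. g (norm z)) \<longlongrightarrow> g (norm y)) (at y within cball 0 1)"
      using gn y by (auto simp: continuous_on)
    then have "((\<lambda>z::'a. \<bar>g (norm z)\<bar>) \<longlongrightarrow> 0) (at y within cball 0 1)"
      using g(2) True by (simp add: tendsto_rabs_zero)
    moreover have "norm (radial_field g z) = \<bar>g (norm z)\<bar>" for z :: 'a
      using g(2) by (cases "z = 0") (simp_all add: radial_field_def abs_mult)
    ultimately have "((\<lambda>z::'a. radial_field g z) \<longlongrightarrow> 0) (at y within cball 0 1)"
      by (subst tendsto_norm_zero_iff[symmetric]) simp
    moreover have "radial_field g y = 0"
      using True by (simp add: radial_field_def)
    ultimately show ?thesis
      by (simp add: continuous_within)
  next
    case False
    have "continuous (at y within cball 0 1) (\<lambda>y. g (norm y))"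
      using gn y by (simp add: continuous_on_eq_continuous_within)
    then have "continuous (at y within cball 0 1) (\<lambda>y. g (norm y) *\<^sub>R (y /\<^sub>R norm y))"
      using False by (intro continuous_intros) auto
    moreover have "eventually (\<lambda>z. z \<noteq> 0) (at y within cball 0 1)"
      using tendsto_imp_eventually_ne[OF tendsto_ident_at False] .
    ultimately show ?thesis
      unfolding continuous_within using False
      by (auto simp: radial_field_def elim!: Lim_transform_eventually eventually_mono)
  qed
qed

text \<open>\<open>g\<close> is continuous on the unit interval only, so
  \<open>radial_field g\<close> is known to be Borel only after restriction to the closed ball;
  measurability of compositions has to pass through the restricted space.\<close>

lemma measurable_comp_continuous_on:
  fixes f :: "'a::topological_space \<Rightarrow> 'b::topological_space"
  assumes "continuous_on S f" "h \<in> borel_measurable M" "\<And>z. z \<in> space M \<Longrightarrow> h z \<in> S"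
  shows "(\<lambda>z. f (h z)) \<in> borel_measurable M"
proof -
  have "h \<in> M \<rightarrow>\<^sub>M restrict_space borel S"
    using assms by (intro measurable_restrict_space2) auto
  from measurable_compose[OF this borel_measurable_continuous_on_restrict[OF assms(1)]]
  show ?thesis .
qed

subsection \<open>The vector field \<open>V\<close>\<close>

text \<open>This is the setting for a single nonnegative measure. The half-mass condition is left to
  the locale for pairs, since it concerns a difference of two measures, each of which may have large
  atoms by itself.\<close>

locale hersch_data =
  fixes M :: "'b measure" and \<Phi> :: "'b \<Rightarrow> 'a::euclidean_space" and g :: "real \<Rightarrow> real"
  assumes finite: "finite_measure M"
    and measurable_map [measurable]: "\<Phi> \<in> borel_measurable M"
    and map_in_cball: "z \<in> space M \<Longrightarrow> \<Phi> z \<in> cball 0 1"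
    and continuous: "continuous_on {0..1} g"
    and zero: "g 0 = 0"
begin

definition field :: "'a \<Rightarrow> 'a" where
  "field x = (LINT z|M. radial_field g (mobius x (\<Phi> z)))"

lemma radial_field_bound:
  "\<exists>B. \<forall>y\<in>(cball 0 1 :: 'a set). norm (radial_field g y) \<le> B"
proof -
  have "compact (radial_field g ` (cball 0 1 :: 'a set))"
    by (intro compact_continuous_image continuous_on_radial_field continuous zero compact_cball)
  then have "bounded (radial_field g ` (cball 0 1 :: 'a set))"
    by (rule compact_imp_bounded)
  then show ?thesis
    by (auto simp: bounded_iff)
qed

lemma measurable_integrand:
  assumes "x \<in> ball 0 1"
  shows "(\<lambda>z. radial_field g (mobius x (\<Phi> z))) \<in> borel_measurable M"
  by (rule measurable_comp_continuous_on[OF continuous_on_radial_field[OF continuous zero]])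
     (use assms map_in_cball mobius_in_cball in auto)

lemma integrable_integrand:
  assumes "x \<in> ball 0 1"
  shows "integrable M (\<lambda>z. radial_field g (mobius x (\<Phi> z)))"
proof -
  interpret finite_measure M by (rule finite)
  obtain B where "\<And>y::'a. y \<in> cball 0 1 \<Longrightarrow> norm (radial_field g y) \<le> B"
    using radial_field_bound by blast
  then show ?thesis
    using assms map_in_cball mobius_in_cball
    by (intro integrable_const_bound[where B = B] AE_I2 measurable_integrand) blast+
qed

lemma continuous_on_field: "continuous_on (ball 0 1) field"
proof (subst continuous_on_sequentially, intro allI impI ballI, elim conjE)
  fix X :: "nat \<Rightarrow> 'a" and x
  assume x: "x \<in> ball 0 1" and X: "\<forall>n. X n \<in> ball 0 1" "X \<longlonglongrightarrow> x"
  interpret finite_measure M by (rule finite)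
  obtain B where B: "\<And>y::'a. y \<in> cball 0 1 \<Longrightarrow> norm (radial_field g y) \<le> B"
    using radial_field_bound by blast
  have "(\<lambda>n. field (X n)) \<longlonglongrightarrow> field x"
    unfolding field_def
  proof (rule integral_dominated_convergence[where w = "\<lambda>_. B"])
    show "AE z in M. (\<lambda>n. radial_field g (mobius (X n) (\<Phi> z))) \<longlonglongrightarrow> radial_field g (mobius x (\<Phi> z))"
    proof (rule AE_I2)
      fix z assume z: "z \<in> space M"
      have "(\<lambda>n. mobius (X n) (\<Phi> z)) \<longlonglongrightarrow> mobius x (\<Phi> z)"
        using mobius_denom_pos[of x "\<Phi> z"] x map_in_cball[OF z] X by (intro tendsto_mobius) auto
      then show "(\<lambda>n. radial_field g (mobius (X n) (\<Phi> z))) \<longlonglongrightarrow> radial_field g (mobius x (\<Phi> z))"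
        by (rule continuous_on_tendsto_compose[OF continuous_on_radial_field[OF continuous zero]])
           (use x X z map_in_cball mobius_in_cball in \<open>auto intro!: always_eventually\<close>)
    qed
    show "AE z in M. norm (radial_field g (mobius (X n) (\<Phi> z))) \<le> B" for n
      using B X(1) map_in_cball mobius_in_cball by (intro AE_I2) blast
  qed (use x X in \<open>auto intro!: measurable_integrand\<close>)
  then show "(field \<circ> X) \<longlonglongrightarrow> field x"
    by (simp add: o_def)
qed

text \<open>As \<open>x\<close> tends to the boundary point \<open>p\<close>, \<open>T\<^sub>x\<close> tends to the constant \<open>p\<close> off \<open>- p\<close>;
  only a point mass at \<open>- p\<close> is not carried along.\<close>

lemma field_boundary_limit:
  assumes p: "p \<in> sphere 0 1" and X: "\<And>n. X n \<in> ball 0 1" "X \<longlonglongrightarrow> p"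
  defines "a \<equiv> measure M {z \<in> space M. \<Phi> z = - p}"
  shows "(\<lambda>n. field (X n) - a *\<^sub>R radial_field g (mobius (X n) (- p)))
           \<longlonglongrightarrow> ((measure M (space M) - a) * g 1) *\<^sub>R p"
proof -
  interpret finite_measure M by (rule finite)
  define A where "A = {z \<in> space M. \<Phi> z = - p}"
  have A [measurable]: "A \<in> sets M" unfolding A_def by measurable
  obtain B where B: "\<And>y::'a. y \<in> cball 0 1 \<Longrightarrow> norm (radial_field g y) \<le> B"
    using radial_field_bound by blast
  have B0: "0 \<le> B" using B[of 0] by (simp add: radial_field_def)
  \<comment> \<open>On \<open>A\<close> the integrand does not depend on \<open>z\<close>, since
    \<open>\<Phi> z = - p\<close> there; removing \<open>A\<close> therefore subtracts exactly
    \<open>a\<close> times the radial field at \<open>mobius (X n) (- p)\<close>.\<close>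
  define R where "R = (\<lambda>n z. indicator (space M - A) z *\<^sub>R radial_field g (mobius (X n) (\<Phi> z)))"
  have int_ind: "integrable M (\<lambda>z. indicator (A :: 'b set) z *\<^sub>R (c::'a))" for c
    by (intro integrable_scaleR_left integrable_real_indicator) (auto simp: less_top[symmetric])
  have split: "field (X n) - a *\<^sub>R radial_field g (mobius (X n) (- p)) = (LINT z|M. R n z)" for n
  proof -
    have "a *\<^sub>R radial_field g (mobius (X n) (- p))
        = (LINT z|M. indicator A z *\<^sub>R radial_field g (mobius (X n) (- p)))"
      by (subst integral_scaleR_left) (auto simp: a_def A_def[symmetric] less_top[symmetric])
    then have "field (X n) - a *\<^sub>R radial_field g (mobius (X n) (- p))
        = (LINT z|M. radial_field g (mobius (X n) (\<Phi> z)) - indicator A z *\<^sub>R radial_field g (mobius (X n) (- p)))"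
      unfolding field_def
      by (simp add: Bochner_Integration.integral_diff[OF integrable_integrand[OF X(1)] int_ind])
    also have "\<dots> = (LINT z|M. R n z)"
      by (rule Bochner_Integration.integral_cong) (auto simp: R_def A_def indicator_def)
    finally show ?thesis .
  qed
  have gp: "radial_field g p = g 1 *\<^sub>R p"
    using p by (auto simp: radial_field_def)
  have "(\<lambda>n. LINT z|M. R n z) \<longlonglongrightarrow> (LINT z|M. indicator (space M - A) z *\<^sub>R (g 1 *\<^sub>R p))"
  proof (rule integral_dominated_convergence[where w = "\<lambda>_. B"])
    show "AE z in M. (\<lambda>n. R n z) \<longlonglongrightarrow> indicator (space M - A) z *\<^sub>R (g 1 *\<^sub>R p)"
    proof (rule AE_I2)
      fix z assume z: "z \<in> space M"
      show "(\<lambda>n. R n z) \<longlonglongrightarrow> indicator (space M - A) z *\<^sub>R (g 1 *\<^sub>R p)"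
      proof (cases "z \<in> A")
        case False
        then have ne: "\<Phi> z \<noteq> - p" using z by (simp add: A_def)
        then have "p + \<Phi> z \<noteq> 0" by (metis add_eq_0_iff)
        then have "(\<lambda>n. mobius (X n) (\<Phi> z)) \<longlonglongrightarrow> mobius p (\<Phi> z)"
          using mobius_denom_boundary[OF p, of "\<Phi> z"] by (intro tendsto_mobius X) simp
        then have "(\<lambda>n. radial_field g (mobius (X n) (\<Phi> z))) \<longlonglongrightarrow> radial_field g p"
          unfolding mobius_boundary[OF p ne]
          by (rule continuous_on_tendsto_compose[OF continuous_on_radial_field[OF continuous zero]])
             (use p X z map_in_cball mobius_in_cball in \<open>auto intro!: always_eventually\<close>)
        then show ?thesis using False z by (simp add: R_def gp)
      qed (simp add: R_def)
    qed
    show "R n \<in> borel_measurable M" for n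
      using measurable_integrand[OF X(1), of n] unfolding R_def by measurable
    show "AE z in M. norm (R n z) \<le> B" for n
      using B B0 mobius_in_cball[OF X(1) map_in_cball]
      by (intro AE_I2) (auto simp: R_def indicator_def simp del: mem_cball_0)
  qed auto
  moreover have "measure M (space M - A) = measure M (space M) - a"
    by (simp add: finite_measure_compl a_def A_def[symmetric])
  moreover have "(LINT z|M. indicator (space M - A) z *\<^sub>R (g 1 *\<^sub>R p))
      = measure M (space M - A) *\<^sub>R (g 1 *\<^sub>R p)"
    by (subst integral_scaleR_left) (auto simp: less_top[symmetric])
  ultimately show ?thesis
    unfolding split by (simp only: scaleR_scaleR)
qed

end

section \<open>Zeros of fields that point outward near the boundary\<close>

lemma zero_if_outward_on_sphere:
  fixes V :: "'a::euclidean_space \<Rightarrow> 'a"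
  assumes "0 < r" "continuous_on (cball 0 r) V" "\<And>x. x \<in> sphere 0 r \<Longrightarrow> V x \<bullet> x > 0"
  obtains x where "x \<in> cball 0 r" "V x = 0"
proof (rule ccontr)
  assume "\<not> thesis"
  then have nz: "\<And>x. x \<in> cball 0 r \<Longrightarrow> V x \<noteq> 0" using that by blast
  \<comment> \<open>\<open>?h\<close> rescales \<open>- V\<close> to length \<open>r\<close>. A
    fixed point would lie on the sphere, with \<open>V x\<close> a negative multiple of
    \<open>x\<close>, against the outward condition.\<close>
  let ?h = "\<lambda>x. (- r / norm (V x)) *\<^sub>R V x"
  have "continuous_on (cball 0 r) ?h"
    using nz assms(2) by (intro continuous_intros) auto
  moreover have "?h ` cball 0 r \<subseteq> cball 0 r"
    using nz assms(1) by auto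
  ultimately obtain x where x: "x \<in> cball 0 r" "?h x = x"
    using brouwer_ball[OF assms(1)] by blast
  have "norm (?h x) = r"
    using nz[OF x(1)] assms(1) by simp
  then have "0 < V x \<bullet> x"
    using x(2) assms(3)[of x] by (simp only: mem_sphere dist_0_norm)
  moreover have "V x \<bullet> x = - r / norm (V x) * (V x \<bullet> V x)"
    by (subst x(2)[symmetric]) simp
  moreover have "\<dots> \<le> 0"
    using assms(1) by (simp add: divide_nonpos_nonneg mult_nonpos_nonneg)
  ultimately show False
    by simp
qed

locale hersch_pair =
  P: hersch_data P \<Phi> g + N: hersch_data N \<Phi> g
  for P N :: "'b measure" and \<Phi> :: "'b \<Rightarrow> 'a::euclidean_space" and g :: "real \<Rightarrow> real" +
  assumes positive: "0 < g 1"
    and mass: "measure N (space N) < measure P (space P)"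
    and atoms: "y \<in> sphere 0 1 \<Longrightarrow>
      2 * (measure P {z \<in> space P. \<Phi> z = y} - measure N {z \<in> space N. \<Phi> z = y})
        < measure P (space P) - measure N (space N)"
begin

abbreviation V :: "'a \<Rightarrow> 'a" where
  "V x \<equiv> P.field x - N.field x"

lemma not_inward_at_boundary:
  assumes p: "p \<in> sphere 0 1" and X: "\<And>n. X n \<in> ball 0 1" "X \<longlonglongrightarrow> p"
  shows "\<not> (\<forall>n. V (X n) \<bullet> X n \<le> 0)"
proof
  assume inward: "\<forall>n. V (X n) \<bullet> X n \<le> 0"
  define m where "m = measure P (space P) - measure N (space N)"
  define a where "a = measure P {z \<in> space P. \<Phi> z = - p} - measure N {z \<in> space N. \<Phi> z = - p}"
  let ?v = "\<lambda>n. radial_field g (mobius (X n) (- p))"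
  have "(\<lambda>n. V (X n) - a *\<^sub>R ?v n) \<longlonglongrightarrow> ((m - a) * g 1) *\<^sub>R p"
    using tendsto_diff[OF P.field_boundary_limit[OF p X] N.field_boundary_limit[OF p X]]
    by (simp add: m_def a_def algebra_simps)
  then have lim: "(\<lambda>n. (V (X n) - a *\<^sub>R ?v n) \<bullet> X n) \<longlonglongrightarrow> (((m - a) * g 1) *\<^sub>R p) \<bullet> p"
    by (intro tendsto_inner X)
  \<comment> \<open>By \<open>inward\<close> the \<open>V\<close> term only lowers the left side.
    For the atom term, Cauchy-Schwarz with the lengths \<open>g 1\<close> and
    \<open>norm (X n) < 1\<close> gives a bound valid for every way of approaching
    \<open>p\<close>.\<close>
  have "(V (X n) - a *\<^sub>R ?v n) \<bullet> X n \<le> \<bar>a\<bar> * g 1" for n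
  proof -
    have "mobius (X n) (- p) \<in> sphere 0 1"
      using mobius_in_sphere[OF X(1)] p by simp
    then have "norm (?v n) = g 1"
      using positive by (auto simp: radial_field_def)
    then have "\<bar>?v n \<bullet> X n\<bar> \<le> g 1 * norm (X n)"
      by (metis Cauchy_Schwarz_ineq2)
    also have "\<dots> \<le> g 1"
      using X(1)[of n] positive by simp
    finally have "\<bar>a\<bar> * \<bar>?v n \<bullet> X n\<bar> \<le> \<bar>a\<bar> * g 1"
      by (intro mult_left_mono) auto
    then have "- (a * (?v n \<bullet> X n)) \<le> \<bar>a\<bar> * g 1"
      by (metis abs_ge_minus_self abs_mult order_trans)
    then show ?thesis
      using inward[rule_format, of n] by (simp add: inner_diff_left)
  qed
  then have "(((m - a) * g 1) *\<^sub>R p) \<bullet> p \<le> \<bar>a\<bar> * g 1"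
    by (intro LIMSEQ_le_const2[OF lim]) blast
  then have "m - a \<le> \<bar>a\<bar>"
    using p positive by (simp add: dot_square_norm)
  moreover have "2 * a < m" "0 < m"
    using atoms[of "- p"] p mass by (auto simp: a_def m_def)
  ultimately show False by linarith
qed

lemma zero_in_ball: "\<exists>x\<in>ball 0 1. V x = 0"
proof -
  \<comment> \<open>Outwardness is known only along sequences tending to the boundary. If every
    radius had a bad point, bad points on radii increasing to 1 would accumulate at a boundary point
    by compactness. The shift by 2 keeps all these radii strictly between 0 and 1.\<close>
  have "\<exists>r>0. r < 1 \<and> (\<forall>x\<in>sphere 0 r. V x \<bullet> x > 0)"
  proof (rule ccontr)
    assume contra: "\<not> ?thesis"
    have "\<exists>x. norm x = 1 - 1 / real (n + 2) \<and> V x \<bullet> x \<le> 0" for n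
    proof -
      have "0 < 1 - 1 / real (n + 2)" "1 - 1 / real (n + 2) < 1" by auto
      then obtain x where "x \<in> sphere 0 (1 - 1 / real (n + 2))" "\<not> V x \<bullet> x > 0"
        using contra by blast
      then show ?thesis
        by (intro exI[of _ x]) (auto simp: not_less)
    qed
    then obtain X where X: "\<And>n. norm (X n) = 1 - 1 / real (n + 2)" "\<And>n. V (X n) \<bullet> X n \<le> 0"
      by metis
    have "\<forall>n. X n \<in> cball 0 1" using X(1) by auto
    then obtain p s where s: "strict_mono s" "(X \<circ> s) \<longlonglongrightarrow> p"
      using compact_cball unfolding compact_def by metis
    have "(\<lambda>n. 1 - 1 / real (n + 2)) \<longlonglongrightarrow> 1 - 0"
      by (intro tendsto_diff tendsto_const LIMSEQ_ignore_initial_segment lim_1_over_n)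
    then have "(\<lambda>n. norm (X n)) \<longlonglongrightarrow> 1" using X(1) by simp
    then have "(\<lambda>n. norm ((X \<circ> s) n)) \<longlonglongrightarrow> 1"
      using LIMSEQ_subseq_LIMSEQ[OF _ s(1)] by (auto simp: o_def)
    moreover have "(\<lambda>n. norm ((X \<circ> s) n)) \<longlonglongrightarrow> norm p"
      by (intro tendsto_norm s)
    ultimately have "p \<in> sphere 0 1"
      using LIMSEQ_unique by fastforce
    from not_inward_at_boundary[OF this, of "X \<circ> s"] s(2) X show False by auto
  qed
  then obtain r where r: "0 < r" "r < 1" "\<And>x. x \<in> sphere 0 r \<Longrightarrow> V x \<bullet> x > 0"
    by blast
  have sub: "cball 0 r \<subseteq> (ball 0 1 :: 'a set)"
    using r by auto
  have "continuous_on (cball 0 r) V"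
    by (intro continuous_on_diff continuous_on_subset[OF _ sub]
          P.continuous_on_field N.continuous_on_field)
  then show ?thesis
    using zero_if_outward_on_sphere[OF r(1) _ r(3)] sub by blast
qed

end

text \<open>The densities \<open>max 0 f\<close> and \<open>max 0 (- f)\<close> supply the two
  measures. Since preimages of boundary points are null, every atom term vanishes and the half-mass
  condition reduces to a positive total integral.\<close>

theorem hersch_density:
  fixes f :: "'b \<Rightarrow> real" and \<Phi> :: "'b \<Rightarrow> 'a::euclidean_space"
  assumes f: "integrable M f" "(LINT z|M. f z) \<noteq> 0"
    and \<Phi>: "\<Phi> \<in> borel_measurable M" "\<And>z. z \<in> space M \<Longrightarrow> \<Phi> z \<in> cball 0 1"
    and g: "continuous_on {0..1} g" "g 0 = 0" "g 1 > 0"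
    and null: "\<And>y. y \<in> sphere 0 1 \<Longrightarrow> {z \<in> space M. \<Phi> z = y} \<in> null_sets M"
  shows "\<exists>x\<in>ball 0 1. (LINT z|M. f z *\<^sub>R radial_field g (mobius x (\<Phi> z))) = 0"
proof -
  \<comment> \<open>Changing the sign of \<open>f\<close> does not affect the desired equation, so a
    positive integral suffices; the claim rebinds \<open>f\<close> in order to be applied to
    \<open>- f\<close> as well.\<close>
  have pos: "\<exists>x\<in>ball 0 1. (LINT z|M. f z *\<^sub>R radial_field g (mobius x (\<Phi> z))) = 0"
    if f: "integrable M f" "(LINT z|M. f z) > 0" for f
  proof -
    have [measurable]: "f \<in> borel_measurable M" using f by auto
    define D where "D = (\<lambda>h :: 'b \<Rightarrow> real. density M (\<lambda>z. ennreal (max 0 (h z))))"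
    have data: "hersch_data (D h) \<Phi> g" if h: "integrable M h" for h
    proof (unfold hersch_data_def, intro conjI finite_measureI)
      have "emeasure (D h) (space (D h)) = (\<integral>\<^sup>+z. ennreal (max 0 (h z)) \<partial>M)"
        using h by (auto simp: D_def emeasure_density intro!: nn_integral_cong)
      also have "\<dots> < \<infinity>"
        using integrable_max[OF integrable_zero h] by (simp add: nn_integral_eq_integral)
      finally show "emeasure (D h) (space (D h)) \<noteq> \<infinity>" by simp
    qed (use \<Phi> g in \<open>auto simp: D_def\<close>)
    have int: "(LINT z|D h. k z) = (LINT z|M. max 0 (h z) *\<^sub>R k z)"
      if "k \<in> borel_measurable M" "integrable M h" for h and k :: "'b \<Rightarrow> 'c::{banach,second_countable_topology}"
      unfolding D_def using that by (intro integral_density) auto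
    have mass: "measure (D h) (space (D h)) = (LINT z|M. max 0 (h z))" if h: "integrable M h" for h
    proof -
      interpret hersch_data "D h" \<Phi> g by (rule data[OF h])
      interpret finite_measure "D h" by (rule finite)
      have "measure (D h) (space (D h)) = (LINT z|D h. 1)" by simp
      also have "\<dots> = (LINT z|M. max 0 (h z))"
        using int[OF _ h, of "\<lambda>_. 1 :: real"] by simp
      finally show ?thesis .
    qed
    have atom: "measure (D h) {z \<in> space (D h). \<Phi> z = y} = 0"
      if "y \<in> sphere 0 1" "integrable M h" for y h
    proof -
      have "{z \<in> space M. \<Phi> z = y} \<in> null_sets (D h)"
        unfolding D_def
      proof (subst null_sets_density_iff)
        have "AE z in M. \<Phi> z \<noteq> y"
          using AE_not_in[OF null[OF that(1)]] AE_space by eventually_elim auto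
        then have "AE z in M. z \<in> {z \<in> space M. \<Phi> z = y} \<longrightarrow> ennreal (max 0 (h z)) = 0"
          by eventually_elim auto
        then show "{z \<in> space M. \<Phi> z = y} \<in> sets M \<and>
            (AE z in M. z \<in> {z \<in> space M. \<Phi> z = y} \<longrightarrow> ennreal (max 0 (h z)) = 0)"
          using null[OF that(1)] by blast
      qed (use that in auto)
      then show ?thesis by (simp add: D_def measure_eq_0_null_sets)
    qed
    have mf: "integrable M (\<lambda>z. - f z)" using f by simp
    have split: "f z = max 0 (f z) - max 0 (- f z)" for z by auto
    have diff: "(LINT z|M. f z) = (LINT z|M. max 0 (f z)) - (LINT z|M. max 0 (- f z))"
      by (subst split, rule Bochner_Integration.integral_diff) (use f in \<open>auto intro!: integrable_max\<close>)
    interpret P: hersch_data "D f" \<Phi> g by (rule data[OF f(1)])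
    interpret N: hersch_data "D (\<lambda>z. - f z)" \<Phi> g by (rule data[OF mf])
    interpret hersch_pair "D f" "D (\<lambda>z. - f z)" \<Phi> g
      by unfold_locales
         (use g f(2) in \<open>auto simp: mass[OF f(1)] mass[OF mf] diff atom[OF _ f(1)] atom[OF _ mf]\<close>)
    obtain x where x: "x \<in> ball 0 1" "V x = 0"
      using zero_in_ball by blast
    let ?k = "\<lambda>z. radial_field g (mobius x (\<Phi> z))"
    have k: "?k \<in> borel_measurable M"
      using P.measurable_integrand[OF x(1)] by (simp add: D_def)
    have ip: "integrable M (\<lambda>z. max 0 (f z) *\<^sub>R ?k z)"
      using P.integrable_integrand[OF x(1)] k unfolding D_def
      by (subst (asm) integrable_density) auto
    have "integrable M (\<lambda>z. max 0 (- f z) *\<^sub>R ?k z)"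
      using N.integrable_integrand[OF x(1)] k unfolding D_def
      by (subst (asm) integrable_density) auto
    then have "(LINT z|M. max 0 (f z) *\<^sub>R ?k z - max 0 (- f z) *\<^sub>R ?k z) = V x"
      by (simp add: P.field_def N.field_def int[OF k f(1)] int[OF k mf] Bochner_Integration.integral_diff[OF ip])
    moreover have "max 0 (f z) *\<^sub>R ?k z - max 0 (- f z) *\<^sub>R ?k z = f z *\<^sub>R ?k z" for z
      by (subst (3) split) (simp only: scaleR_diff_left)
    ultimately show ?thesis using x by auto
  qed
  show ?thesis
  proof (cases "(LINT z|M. f z) > 0")
    case True
    then show ?thesis using pos f by blast
  next
    case False
    then have "(LINT z|M. - f z) > 0" using f by simp
    from pos[OF _ this] f show ?thesis by auto
  qed
qed

subsection \<open>Finite signed measures\<close>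

text \<open>Real values avoid subtraction of infinities, and the uniform bound \<open>K\<close>
  keeps both Jordan parts finite. The conditions are invariant under negation, so each fact about
  the positive part also serves for the negative part.\<close>

locale real_signed_measure =
  fixes M :: "'b measure" and m :: "'b set \<Rightarrow> real" and K :: real
  assumes empty [simp]: "m {} = 0"
    and sums: "range A \<subseteq> sets M \<Longrightarrow> disjoint_family A \<Longrightarrow> (\<lambda>i. m (A i)) sums m (\<Union>i::nat. A i)"
    and bounded: "B \<in> sets M \<Longrightarrow> \<bar>m B\<bar> \<le> K"
begin

lemma uminus: "real_signed_measure M (\<lambda>A. - m A) K"
  by unfold_locales (auto intro!: sums_minus sums bounded)

lemma add:
  assumes "A \<in> sets M" "B \<in> sets M" "A \<inter> B = {}"
  shows "m (A \<union> B) = m A + m B"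
proof -
  have "(\<lambda>n. m (binaryset A B n)) sums m (\<Union>i. binaryset A B i)"
    using assms by (intro sums) (auto simp: range_binaryset_eq disjoint_family_on_def binaryset_def)
  moreover have "(\<lambda>n. m (binaryset A B n)) sums (m A + m B)"
    by (rule binaryset_sums) simp
  ultimately show ?thesis
    by (simp add: UN_binaryset_eq sums_unique2)
qed

definition upper :: "'b set \<Rightarrow> ennreal" where
  "upper A = (SUP B \<in> {B \<in> sets M. B \<subseteq> A}. ennreal (m B))"

abbreviation pos :: "'b measure" where
  "pos \<equiv> positive_part M (\<lambda>A. ereal (m A))"

lemma upper_mono: "A \<subseteq> B \<Longrightarrow> upper A \<le> upper B"
  unfolding upper_def by (intro SUP_subset_mono) auto

lemma upper_upper: "B \<in> sets M \<Longrightarrow> B \<subseteq> A \<Longrightarrow> ennreal (m B) \<le> upper A"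
  unfolding upper_def by (intro SUP_upper) auto

lemma upper_superadd:
  assumes A: "A \<in> sets M" and B: "B \<in> sets M" and disj: "A \<inter> B = {}"
  shows "upper A + upper B \<le> upper (A \<union> B)"
proof -
  have ne: "{B \<in> sets M. B \<subseteq> A} \<noteq> {}" for A
    using sets.empty_sets by blast
  have "ennreal (m C) + ennreal (m D) \<le> upper (A \<union> B)"
    if C: "C \<in> sets M" "C \<subseteq> A" and D: "D \<in> sets M" "D \<subseteq> B" for C D
  proof -
    \<comment> \<open>\<open>ennreal\<close> truncates negative values to 0. A set of negative
      measure is replaced by the empty set, which has the same truncated value, so that the
      truncated sum becomes the measure of a disjoint union.\<close>
    define C' where "C' = (if 0 \<le> m C then C else {})"
    define D' where "D' = (if 0 \<le> m D then D else {})"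
    have C': "C' \<in> sets M" "C' \<subseteq> A" "0 \<le> m C'" "ennreal (m C) = ennreal (m C')"
      using C by (auto simp: C'_def ennreal_neg)
    have D': "D' \<in> sets M" "D' \<subseteq> B" "0 \<le> m D'" "ennreal (m D) = ennreal (m D')"
      using D by (auto simp: D'_def ennreal_neg)
    have "ennreal (m C) + ennreal (m D) = ennreal (m (C' \<union> D'))"
      using C' D' disj by (subst add) auto
    also have "\<dots> \<le> upper (A \<union> B)"
      using C' D' by (intro upper_upper) auto
    finally show ?thesis .
  qed
  then show ?thesis
    unfolding upper_def[of A] upper_def[of B]
      ennreal_SUP_add_left[OF ne, symmetric] ennreal_SUP_add_right[OF ne]
    by (intro SUP_least) blast
qed

text \<open>Superadditivity handles finite unions, and monotonicity the passage to the limit. For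
  the converse, a test set \<open>B\<close> is cut along the \<open>A i\<close>, and each piece is a
  test set for its \<open>A i\<close>.\<close>

lemma upper_suminf:
  assumes A: "range A \<subseteq> sets M" "disjoint_family A"
  shows "(\<Sum>i. upper (A i)) = upper (\<Union>i. A i)"
proof (rule antisym)
  have "(\<Sum>i<n. upper (A i)) \<le> upper (\<Union>i<n. A i)" for n
  proof (induction n)
    case (Suc n)
    have "A i \<inter> A n = {}" if "i < n" for i
      using A(2) that by (simp add: disjoint_family_on_def)
    then have "(\<Union>i<n. A i) \<inter> A n = {}" by blast
    then have "upper (\<Union>i<n. A i) + upper (A n) \<le> upper ((\<Union>i<n. A i) \<union> A n)"
      using A(1) by (intro upper_superadd) auto
    moreover have "(\<Union>i<n. A i) \<union> A n = (\<Union>i<Suc n. A i)"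
      by (auto simp: less_Suc_eq)
    ultimately show ?case
      using order_trans[OF add_right_mono[OF Suc]] by (simp del: UN_simps)
  qed simp
  then have "(\<Sum>i<n. upper (A i)) \<le> upper (\<Union>i. A i)" for n
    by (rule order_trans) (auto intro: upper_mono)
  then show "(\<Sum>i. upper (A i)) \<le> upper (\<Union>i. A i)"
    by (intro suminf_le_const) auto
next
  show "upper (\<Union>i. A i) \<le> (\<Sum>i. upper (A i))"
    unfolding upper_def[of "\<Union>i. A i"]
  proof (intro SUP_least)
    fix B assume "B \<in> {B \<in> sets M. B \<subseteq> (\<Union>i. A i)}"
    then have B: "B \<in> sets M" "B \<subseteq> (\<Union>i. A i)" by auto
    have "(\<lambda>i. m (B \<inter> A i)) sums m (\<Union>i. B \<inter> A i)"
      using A B by (intro sums) (auto simp: disjoint_family_on_def)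
    moreover have "(\<Union>i. B \<inter> A i) = B" using B by auto
    ultimately have s: "(\<lambda>i. m (B \<inter> A i)) sums m B" by simp
    have part: "ennreal (\<Sum>i<n. m (B \<inter> A i)) \<le> (\<Sum>i. upper (A i))" for n
    proof -
      have "ennreal (\<Sum>i<n. m (B \<inter> A i)) \<le> (\<Sum>i<n. upper (A i))"
      proof (induction n)
        case (Suc n)
        \<comment> \<open>Truncation at 0 is subadditive: cancellation between pieces of opposite
          sign can only lower the left side.\<close>
        have "ennreal (\<Sum>i<Suc n. m (B \<inter> A i)) \<le> ennreal (\<Sum>i<n. m (B \<inter> A i)) + ennreal (m (B \<inter> A n))"
          by (cases "0 \<le> (\<Sum>i<n. m (B \<inter> A i))"; cases "0 \<le> m (B \<inter> A n)")
             (simp_all add: ennreal_neg ennreal_leI flip: ennreal_plus)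
        also have "\<dots> \<le> (\<Sum>i<n. upper (A i)) + upper (A n)"
          using A B by (intro add_mono Suc upper_upper) auto
        finally show ?case by simp
      qed simp
      also have "\<dots> \<le> (\<Sum>i. upper (A i))"
        by (intro sum_le_suminf) auto
      finally show ?thesis .
    qed
    have "(\<lambda>n. ennreal (\<Sum>i<n. m (B \<inter> A i))) \<longlonglongrightarrow> ennreal (m B)"
      using s by (intro tendsto_ennrealI) (simp add: sums_def)
    then show "ennreal (m B) \<le> (\<Sum>i. upper (A i))"
      using part by (intro LIMSEQ_le_const2) auto
  qed
qed

lemma space_pos [simp]: "space pos = space M"
  and sets_pos [simp]: "sets pos = sets M"
  by (simp_all add: positive_part_def)

lemma emeasure_pos:
  assumes "A \<in> sets M"
  shows "emeasure pos A = upper A"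
proof -
  have "pos = measure_of (space M) (sets M) upper"
    by (simp add: positive_part_def upper_def[abs_def])
  then show ?thesis
  proof (rule emeasure_measure_of)
    show "positive (sets pos) upper"
      by (auto simp: positive_def upper_def bot_ennreal)
    show "countably_additive (sets pos) upper"
      by (auto simp: countably_additive_def upper_suminf)
  qed (use assms sets.space_closed in auto)
qed

lemma upper_le: "upper A \<le> ennreal K"
  unfolding upper_def by (intro SUP_least ennreal_leI) (auto dest: bounded)

lemma finite_measure_pos: "finite_measure pos"
proof
  have "emeasure pos (space pos) \<le> ennreal K"
    by (simp add: emeasure_pos upper_le)
  also have "\<dots> < \<infinity>" by simp
  finally show "emeasure pos (space pos) \<noteq> \<infinity>" by simp
qed

lemma measure_pos_ge:
  assumes "B \<in> sets M" "A \<in> sets M" "B \<subseteq> A"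
  shows "m B \<le> measure pos A"
proof -
  interpret finite_measure pos by (rule finite_measure_pos)
  have "ennreal (m B) \<le> ennreal (measure pos A)"
    using upper_upper[OF assms(1,3)] assms(2) by (simp add: emeasure_pos emeasure_eq_measure[symmetric])
  then show ?thesis by simp
qed

lemma measure_pos_le:
  assumes A: "A \<in> sets M" and c: "\<And>B. B \<in> sets M \<Longrightarrow> B \<subseteq> A \<Longrightarrow> m B \<le> c"
  shows "measure pos A \<le> c"
proof -
  interpret finite_measure pos by (rule finite_measure_pos)
  have "0 \<le> c" using c[of "{}"] by simp
  have "upper A \<le> ennreal c"
    unfolding upper_def using c by (auto intro!: SUP_least ennreal_leI)
  then show ?thesis
    using A \<open>0 \<le> c\<close> by (simp add: emeasure_pos[symmetric] emeasure_eq_measure)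
qed

text \<open>For \<open>B \<subseteq> A\<close> the value \<open>- m B\<close> equals
  \<open>m (A - B) - m A\<close>, and \<open>m (A - B)\<close> is at most the positive part of
  \<open>A\<close>; the bound then passes to the supremum over \<open>B\<close>.\<close>

lemma jordan_le:
  assumes A: "A \<in> sets M"
  shows "measure (positive_part M (\<lambda>A. ereal (- m A))) A \<le> measure pos A - m A"
proof (rule real_signed_measure.measure_pos_le[OF uminus A])
  fix B assume B: "B \<in> sets M" "B \<subseteq> A"
  have "m A = m (A - B) + m B"
    using add[of "A - B" B] A B by (simp add: Un_absorb2 Int_commute)
  moreover have "m (A - B) \<le> measure pos A"
    using A B by (intro measure_pos_ge) auto
  ultimately show "- m B \<le> measure pos A - m A" by simp
qed

text \<open>The two inequalities are the preceding bound for \<open>m\<close> and for its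
  negative.\<close>

lemma jordan:
  assumes A: "A \<in> sets M"
  shows "measure pos A - measure (positive_part M (\<lambda>A. ereal (- m A))) A = m A"
  using jordan_le[OF A] real_signed_measure.jordan_le[OF uminus A] by simp

text \<open>The hypothesis that every measurable set is a preimage excludes the cancellation between
  \<open>\<mu>\<^sup>+\<close> and \<open>\<mu>\<^sup>-\<close> that a general push-forward may cause.\<close>

lemma positive_part_pushforward:
  fixes M' :: "'c measure"
  assumes h: "h \<in> M \<rightarrow>\<^sub>M M'"
    and pre: "\<And>B. B \<in> sets M \<Longrightarrow> \<exists>C\<in>sets M'. B = h -` C \<inter> space M"
  shows "positive_part M' (\<lambda>A. ereal (m (h -` A \<inter> space M))) = distr pos M' h"
proof -
  interpret push: real_signed_measure M' "\<lambda>A. m (h -` A \<inter> space M)" K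
  proof
    fix A :: "nat \<Rightarrow> 'c set" assume A: "range A \<subseteq> sets M'" "disjoint_family A"
    have "(\<lambda>i. m (h -` A i \<inter> space M)) sums m (\<Union>i. h -` A i \<inter> space M)"
      using A h by (intro sums) (fastforce simp: disjoint_family_on_def intro: measurable_sets)+
    moreover have "(\<Union>i. h -` A i \<inter> space M) = h -` (\<Union>i. A i) \<inter> space M" by auto
    ultimately show "(\<lambda>i. m (h -` A i \<inter> space M)) sums m (h -` (\<Union>i. A i) \<inter> space M)" by simp
  qed (use h in \<open>auto intro: bounded measurable_sets\<close>)
  show ?thesis
  proof (rule measure_eqI)
    fix A assume "A \<in> sets push.pos"
    then have A: "A \<in> sets M'" by simp
    have "(\<lambda>C. h -` C \<inter> space M) ` {C \<in> sets M'. C \<subseteq> A} = {B \<in> sets M. B \<subseteq> h -` A \<inter> space M}" (is "?L = ?R")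
    proof (intro equalityI subsetI)
      fix B assume "B \<in> ?R"
      then have B: "B \<in> sets M" "B \<subseteq> h -` A \<inter> space M" by auto
      then obtain C where C: "C \<in> sets M'" "B = h -` C \<inter> space M" using pre by blast
      \<comment> \<open>\<open>C\<close> may reach beyond \<open>A\<close>, but \<open>B\<close>
        lies over \<open>A\<close>, so intersecting with \<open>A\<close> leaves the preimage
        unchanged.\<close>
      have "B = h -` (C \<inter> A) \<inter> space M" using B C by auto
      then show "B \<in> ?L" using C A by blast
    qed (use h in \<open>auto intro: measurable_sets\<close>)
    moreover have "push.upper A
        = (SUP B\<in>(\<lambda>C. h -` C \<inter> space M) ` {C \<in> sets M'. C \<subseteq> A}. ennreal (m B))"
      unfolding push.upper_def by (simp only: image_image)
    ultimately have "push.upper A = upper (h -` A \<inter> space M)"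
      unfolding upper_def by simp
    then show "emeasure push.pos A = emeasure (distr pos M' h) A"
      using A h by (simp add: push.emeasure_pos emeasure_distr emeasure_pos measurable_sets measurable_cong_sets[OF sets_pos refl])
  qed simp
qed

end

lemma positive_part_cong:
  assumes "\<And>A. A \<in> sets M \<Longrightarrow> \<mu> A = \<nu> A"
  shows "positive_part M \<mu> = positive_part M \<nu>"
  unfolding positive_part_def using assms by (intro arg_cong[where f = "measure_of _ _"] ext SUP_cong) auto

section \<open>Extended-real signed measures of finite total variation\<close>

locale finite_signed_measure =
  fixes M :: "'b measure" and \<mu> :: "'b set \<Rightarrow> ereal"
  assumes signed: "signed_measure M \<mu>"
    and finite_variation: "total_variation M \<mu> (space M) < \<infinity>"
begin

definition m :: "'b set \<Rightarrow> real" where "m A = real_of_ereal (\<mu> A)"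

definition K :: real where "K = real_of_ereal (total_variation M \<mu> (space M))"

lemma abs_le_variation:
  assumes "A \<in> sets M"
  shows "\<bar>\<mu> A\<bar> \<le> total_variation M \<mu> (space M)"
proof -
  \<comment> \<open>\<open>A\<close> and its complement, followed by empty sets, form an admissible
    partition of the space, whose initial term is already
    \<open>\<bar>\<mu> A\<bar>\<close>.\<close>
  let ?P = "binaryset A (space M - A)"
  have "\<bar>\<mu> A\<bar> = (\<Sum>n<1. \<bar>\<mu> (?P n)\<bar>)" by (simp add: binaryset_def)
  also have "\<dots> \<le> (\<Sum>n. \<bar>\<mu> (?P n)\<bar>)" by (rule suminf_upper) simp
  also have "\<dots> \<le> total_variation M \<mu> (space M)"
    unfolding total_variation_def
  proof (intro SUP_upper CollectI conjI)
    show "(\<Union>i. ?P i) = space M"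
      using sets.sets_into_space[OF assms] by (auto simp: UN_binaryset_eq)
  qed (use assms in \<open>auto simp: range_binaryset_eq disjoint_family_on_def binaryset_def\<close>)
  finally show ?thesis .
qed

lemma abs_finite: "A \<in> sets M \<Longrightarrow> \<bar>\<mu> A\<bar> \<noteq> \<infinity>"
  using abs_le_variation finite_variation by (metis ereal_infty_less(1) leD)

lemma \<mu>_eq: "A \<in> sets M \<Longrightarrow> \<mu> A = ereal (m A)"
  using abs_finite by (simp add: m_def ereal_real')

sublocale real_signed_measure M m K
proof
  show "m {} = 0" using signed by (simp add: m_def signed_measure_def)
  fix A :: "nat \<Rightarrow> 'b set" assume A: "range A \<subseteq> sets M" "disjoint_family A"
  then have "(\<lambda>i. \<mu> (A i)) sums \<mu> (\<Union>i. A i)"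
    using signed by (simp add: signed_measure_def)
  then show "(\<lambda>i. m (A i)) sums m (\<Union>i. A i)"
    using A(1) by (subst sums_ereal[symmetric]) (simp add: \<mu>_eq[symmetric] sets.countable_UN range_subsetD)
next
  fix A assume A: "A \<in> sets M"
  have "ereal \<bar>m A\<bar> \<le> total_variation M \<mu> (space M)"
    using abs_le_variation[OF A] by (simp add: \<mu>_eq[OF A])
  then show "\<bar>m A\<bar> \<le> K"
    using finite_variation unfolding K_def
    by (cases "total_variation M \<mu> (space M)") auto
qed

lemma positive_part_eq: "positive_part M \<mu> = pos"
  by (rule positive_part_cong) (rule \<mu>_eq)

lemma negative_part_eq: "negative_part M \<mu> = positive_part M (\<lambda>A. ereal (- m A))"
  unfolding negative_part_def by (rule positive_part_cong) (simp add: \<mu>_eq)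

lemma signed_integral_pushforward:
  fixes k :: "'c \<Rightarrow> 'd::{banach, second_countable_topology}"
  assumes h: "h \<in> M \<rightarrow>\<^sub>M M'"
    and pre: "\<And>B. B \<in> sets M \<Longrightarrow> \<exists>C\<in>sets M'. B = h -` C \<inter> space M"
    and k: "k \<in> borel_measurable M'"
  shows "signed_integral M' (signed_pushforward M h \<mu>) k = signed_integral M \<mu> (\<lambda>y. k (h y))"
proof -
  have eq: "signed_pushforward M h \<mu> A = ereal (m (h -` A \<inter> space M))" if "A \<in> sets M'" for A
    using that h by (simp add: signed_pushforward_def \<mu>_eq measurable_sets)
  have "positive_part M' (signed_pushforward M h \<mu>) = distr pos M' h"
    by (subst positive_part_pushforward[OF h pre, symmetric]) (auto intro: positive_part_cong eq)
  moreover have "negative_part M' (signed_pushforward M h \<mu>)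
      = distr (positive_part M (\<lambda>A. ereal (- m A))) M' h"
    unfolding negative_part_def
    by (subst real_signed_measure.positive_part_pushforward[OF uminus h pre, symmetric])
       (auto intro: positive_part_cong simp: eq)
  moreover have "sets (positive_part M (\<lambda>A. ereal (- m A))) = sets M"
    by (rule real_signed_measure.sets_pos[OF uminus])
  ultimately have "h \<in> positive_part M (\<lambda>A. ereal (- m A)) \<rightarrow>\<^sub>M M'" "h \<in> pos \<rightarrow>\<^sub>M M'"
    using h by (simp_all cong: measurable_cong_sets)
  with \<open>positive_part M' _ = _\<close> \<open>negative_part M' _ = _\<close> show ?thesis
    using k by (simp add: signed_integral_def positive_part_eq negative_part_eq integral_distr)
qed

end

text \<open>This covers the closed ball and the sphere at once. Applied to \<open>S\<close> and to
  singletons, the Jordan decomposition turns differences of the two parts back into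
  \<open>\<mu>\<close>, and so the hypotheses on \<open>\<mu>\<close> into those on the
  pair.\<close>

theorem hersch_signed:
  fixes S :: "'a::euclidean_space set" and \<mu> :: "'a set \<Rightarrow> ereal"
  defines "M \<equiv> restrict_space borel S"
  assumes S: "S \<in> sets borel" "sphere 0 1 \<subseteq> S" "S \<subseteq> cball 0 1"
    and \<mu>: "signed_measure M \<mu>" "total_variation M \<mu> S < \<infinity>" "0 < \<mu> S"
    and g: "continuous_on {0..1} g" "g 0 = 0" "g 1 > 0"
    and atoms: "\<And>y. y \<in> sphere 0 1 \<Longrightarrow> \<mu> {y} < \<mu> S / 2"
  shows "\<exists>x\<in>ball 0 1. signed_integral M \<mu> (\<lambda>y. radial_field g (mobius x y)) = 0"
proof -
  have sp: "space M = S" by (simp add: M_def space_restrict_space)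
  interpret finite_signed_measure M \<mu>
    by unfold_locales (use \<mu> in \<open>simp_all add: sp\<close>)
  let ?neg = "positive_part M (\<lambda>A. ereal (- m A))"
  interpret neg: real_signed_measure M "\<lambda>A. - m A" K by (rule uminus)
  have SM: "S \<in> sets M" using sets.top[of M] by (simp add: sp)
  have ident: "(\<lambda>y. y) \<in> borel_measurable M"
    unfolding M_def by (rule measurable_restrict_space1) simp
  have data: "hersch_data \<nu> (\<lambda>y. y) g" if "finite_measure \<nu>" "sets \<nu> = sets M" "space \<nu> = S" for \<nu>
    using that ident S g by (auto simp: hersch_data_def measurable_cong_sets[OF that(2) refl])
  interpret P: hersch_data pos "\<lambda>y. y" g
    by (rule data) (auto simp: finite_measure_pos sp)
  interpret N: hersch_data neg.pos "\<lambda>y. y" g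
    by (rule data) (auto simp: neg.finite_measure_pos sp)
  interpret hersch_pair pos neg.pos "\<lambda>y. y" g
  proof
    show "0 < g 1" by (rule g)
    have "0 < m S" using \<mu>(3) by (simp add: \<mu>_eq[OF SM])
    then show "measure neg.pos (space neg.pos) < measure pos (space pos)"
      using jordan[OF SM] by (simp add: sp)
    fix y :: 'a assume y: "y \<in> sphere 0 1"
    then have "{z \<in> S. z = y} = {y}" using S by auto
    moreover have yM: "{y} \<in> sets M"
      using y S unfolding M_def by (subst sets_restrict_space_iff) auto
    moreover have "2 * m {y} < m S"
      using atoms[OF y] by (simp add: \<mu>_eq[OF SM] \<mu>_eq[OF yM] field_simps)
    ultimately show "2 * (measure pos {z \<in> space pos. z = y} - measure neg.pos {z \<in> space neg.pos. z = y})
        < measure pos (space pos) - measure neg.pos (space neg.pos)"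
      using jordan[OF SM] jordan[OF yM] by (simp add: sp)
  qed
  show ?thesis
    using zero_in_ball by (simp add: P.field_def N.field_def signed_integral_def positive_part_eq negative_part_eq)
qed

subsection \<open>Surface measure\<close>

lemma space_sphere_measure [simp]: "space (sphere_measure :: 'a::euclidean_space measure) = sphere 0 1"
  by (simp add: sphere_measure_def space_scale_measure space_restrict_space)

lemma measurable_ident_sphere_measure:
  "(\<lambda>y. y) \<in> borel_measurable (sphere_measure :: 'a::euclidean_space measure)"
  unfolding sphere_measure_def
proof (rule measurable_completion)
  have "(\<lambda>y. y) \<in> borel_measurable (restrict_space borel (sphere 0 1 :: 'a set))"
    by (rule measurable_restrict_space1) simp
  then show "(\<lambda>y. y) \<in> borel_measurable (scale_measure (of_nat DIM('a))
       (distr (restrict_space lborel (ball 0 1 - {0})) (restrict_space borel (sphere 0 1 :: 'a set))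
          (\<lambda>x. x /\<^sub>R norm x)))"
    by simp
qed

text \<open>The cone over a point lies on a line through the origin, which is negligible once the
  dimension is at least 2. In dimension 1 the two points of the sphere are atoms.\<close>

lemma null_sets_sphere_measure_singleton:
  fixes y :: "'a::euclidean_space"
  assumes y: "y \<in> sphere 0 1" and dim: "DIM('a) \<ge> 2"
  shows "{y} \<in> null_sets sphere_measure"
proof -
  let ?B = "ball 0 1 - {0} :: 'a set" and ?h = "\<lambda>x::'a. x /\<^sub>R norm x"
  let ?S = "restrict_space borel (sphere 0 1 :: 'a set)"
  let ?A = "?h -` {y} \<inter> ?B"
  have yS: "{y} \<in> sets ?S"
    using y by (subst sets_restrict_space_iff) auto
  have h: "?h \<in> restrict_space lborel ?B \<rightarrow>\<^sub>M ?S"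
    by (rule measurable_restrict_space3) auto
  have "?A \<subseteq> span {y}"
  proof
    fix x assume "x \<in> ?A"
    then have "x \<noteq> 0" "y = x /\<^sub>R norm x" by auto
    then have "x = norm x *\<^sub>R y" by simp
    then show "x \<in> span {y}"
      by (metis span_base span_scale singletonI)
  qed
  moreover have "negligible (span {y})"
  proof (rule negligible_lowdim)
    have "dim (span {y}) \<le> card {y}" by (simp only: dim_span) (rule dim_le_card, auto intro: span_base)
    then show "dim (span {y}) < DIM('a)" using dim by simp
  qed
  ultimately have "negligible ?A" by (rule negligible_subset[rotated])
  moreover have "?A \<in> sets borel"
  proof -
    have "?h \<in> borel_measurable borel" by measurable
    then have "?h -` {y} \<inter> space borel \<in> sets borel" by (rule measurable_sets) simp
    then show ?thesis by auto
  qed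
  ultimately have "emeasure lborel ?A = 0"
    by (simp add: negligible_iff_null_sets null_sets_def)
  moreover have "?h -` {y} \<inter> space (restrict_space lborel ?B) = ?A"
    by (simp add: space_restrict_space)
  ultimately have "emeasure (distr (restrict_space lborel ?B) ?S ?h) {y} = 0"
    using h yS by (simp add: emeasure_distr emeasure_restrict_space)
  then show ?thesis
    unfolding sphere_measure_def using yS by (intro null_sets_completionI) (simp add: null_sets_def)
qed

subsection \<open>Arclength\<close>

definition polygons :: "real \<Rightarrow> real \<Rightarrow> (nat \<times> (nat \<Rightarrow> real)) set" where
  "polygons a b = {(k, t). mono_on {..k} t \<and> t ` {..k} \<subseteq> {a..b}}"

definition polygon_length :: "(real \<Rightarrow> 'a::metric_space) \<Rightarrow> nat \<times> (nat \<Rightarrow> real) \<Rightarrow> ennreal" where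
  "polygon_length \<gamma> p = (case p of (k, t) \<Rightarrow> \<Sum>i<k. ennreal (dist (\<gamma> (t i)) (\<gamma> (t (Suc i)))))"

lemma curve_length_eq: "curve_length \<gamma> a b = (SUP p\<in>polygons a b. polygon_length \<gamma> p)"
  unfolding curve_length_def polygons_def polygon_length_def ..

lemma curve_length_upper:
  "p \<in> polygons a b \<Longrightarrow> polygon_length \<gamma> p \<le> curve_length \<gamma> a b"
  unfolding curve_length_eq by (rule SUP_upper)

lemma curve_length_mono: "c \<le> a \<Longrightarrow> b \<le> d \<Longrightarrow> curve_length \<gamma> a b \<le> curve_length \<gamma> c d"
  unfolding curve_length_eq by (intro SUP_subset_mono) (auto simp: polygons_def)

lemma curve_length_degenerate:
  assumes "b \<le> a"
  shows "curve_length \<gamma> a b = 0"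
proof -
  have "polygon_length \<gamma> p \<le> 0" if "p \<in> polygons a b" for p
  proof -
    obtain k t where p: "p = (k, t)" by (cases p)
    have "t i = a" if "i \<le> k" for i
      using \<open>p \<in> polygons a b\<close> that assms by (force simp: p polygons_def)
    then show ?thesis by (simp add: p polygon_length_def)
  qed
  then have "curve_length \<gamma> a b \<le> 0"
    unfolding curve_length_eq by (intro SUP_least)
  then show ?thesis by simp
qed

lemma curve_length_superadd:
  assumes "a \<le> c" "c \<le> b"
  shows "curve_length \<gamma> a c + curve_length \<gamma> c b \<le> curve_length \<gamma> a b"
proof -
  have ne: "polygons a c \<noteq> {}" "polygons c b \<noteq> {}"
    using assms by (auto simp: polygons_def mono_on_def intro!: exI[of _ 0] exI[of _ "\<lambda>_. c"])
  have "polygon_length \<gamma> p + polygon_length \<gamma> q \<le> curve_length \<gamma> a b"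
    if pq: "p \<in> polygons a c" "q \<in> polygons c b" for p q
  proof -
    obtain k t where p: "p = (k, t)" by (cases p)
    obtain l u where q: "q = (l, u)" by (cases q)
    have t: "mono_on {..k} t" "\<And>i. i \<le> k \<Longrightarrow> a \<le> t i \<and> t i \<le> c"
      using pq(1) by (auto simp: p polygons_def)
    have u: "mono_on {..l} u" "\<And>i. i \<le> l \<Longrightarrow> c \<le> u i \<and> u i \<le> b"
      using pq(2) by (auto simp: q polygons_def)
    \<comment> \<open>The vertices of \<open>u\<close> follow those of \<open>t\<close>, shifted by
      \<open>Suc k\<close>. The concatenation has the additional edge from \<open>t k\<close> to
      \<open>u 0\<close>, hence \<open>Suc k + l\<close> edges; this edge can only add
      length.\<close>
    define w where "w i = (if i \<le> k then t i else u (i - Suc k))" for i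
    let ?n = "Suc k + l"
    have "w i \<le> w j" if "i \<le> j" "j \<le> ?n" for i j
    proof -
      consider "j \<le> k" | "i \<le> k" "k < j" | "k < i" by linarith
      then show ?thesis
      proof cases
        case 1 then show ?thesis using that t(1) by (auto simp: w_def mono_on_def)
      next
        case 2
        then have "t i \<le> c" "c \<le> u (j - Suc k)" using t(2)[of i] u(2)[of "j - Suc k"] that by auto
        then show ?thesis using 2 by (simp add: w_def)
      next
        case 3
        then show ?thesis
          using monotone_onD[OF u(1), of "i - Suc k" "j - Suc k"] that by (auto simp: w_def)
      qed
    qed
    moreover have "a \<le> w i \<and> w i \<le> b" if "i \<le> ?n" for i
    proof -
      have "i - Suc k \<le> l" using that by linarith
      then show ?thesis
        using t(2)[of i] u(2)[of "i - Suc k"] assms by (auto simp: w_def)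
    qed
    ultimately have w: "(?n, w) \<in> polygons a b"
      by (auto simp: polygons_def mono_on_def)
    let ?d = "\<lambda>w i. ennreal (dist (\<gamma> (w i)) (\<gamma> (w (Suc i))))"
    have "polygon_length \<gamma> p = (\<Sum>i<k. ?d w i)"
      by (simp add: p polygon_length_def w_def)
    moreover have "polygon_length \<gamma> q = (\<Sum>i<l. ?d w (Suc k + i))"
      by (simp add: q polygon_length_def w_def)
    moreover have "(\<Sum>i<?n. ?d w i) = (\<Sum>i<Suc k. ?d w i) + (\<Sum>i<l. ?d w (Suc k + i))"
      by (induction l) (simp_all add: add.assoc)
    moreover have "(\<Sum>i<k. ?d w i) \<le> (\<Sum>i<Suc k. ?d w i)"
      by (intro sum_mono2) auto
    ultimately have "polygon_length \<gamma> p + polygon_length \<gamma> q \<le> polygon_length \<gamma> (?n, w)"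
      unfolding polygon_length_def[of _ "(?n, w)"] prod.case by (simp only: add_right_mono)
    also have "\<dots> \<le> curve_length \<gamma> a b" by (rule curve_length_upper[OF w])
    finally show ?thesis .
  qed
  then show ?thesis
    unfolding curve_length_eq[of \<gamma> a c] curve_length_eq[of \<gamma> c b]
      ennreal_SUP_add_left[OF ne(1), symmetric] ennreal_SUP_add_right[OF ne(2)]
    by (intro SUP_least)
qed

lemma polygons_min:
  assumes "(k, t) \<in> polygons a b" "a \<le> c"
  shows "(k, \<lambda>i. min (t i) c) \<in> polygons a c"
  using assms by (auto simp: polygons_def mono_on_def image_subset_iff min_le_iff_disj)

lemma polygons_max:
  assumes "(k, t) \<in> polygons a b" "c \<le> b"
  shows "(k, \<lambda>i. max (t i) c) \<in> polygons c b"
  using assms by (auto simp: polygons_def mono_on_def image_subset_iff le_max_iff_disj) (meson linear order_trans)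

text \<open>Clamping the vertices at \<open>c\<close> from above and from below splits a polygon
  without reindexing: edges on the wrong side of \<open>c\<close> degenerate to length 0, and an
  edge across \<open>c\<close> becomes two edges meeting at \<open>\<gamma> c\<close>, to which the
  triangle inequality applies.\<close>

lemma curve_length_subadd:
  assumes "a \<le> c" "c \<le> b"
  shows "curve_length \<gamma> a b \<le> curve_length \<gamma> a c + curve_length \<gamma> c b"
  unfolding curve_length_eq[of \<gamma> a b]
proof (rule SUP_least)
  fix p assume p: "p \<in> polygons a b"
  obtain k t where kt: "p = (k, t)" by (cases p)
  let ?d = "\<lambda>w i. dist (\<gamma> (w i)) (\<gamma> (w (Suc i)))"
  have "?d t i \<le> ?d (\<lambda>i. min (t i) c) i + ?d (\<lambda>i. max (t i) c) i" if "i < k" for i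
  proof -
    have "t i \<le> t (Suc i)"
      using p that by (auto simp: kt polygons_def mono_on_def)
    then show ?thesis
      using dist_triangle[of "\<gamma> (t i)" "\<gamma> (t (Suc i))" "\<gamma> c"] by (auto simp: min_def max_def)
  qed
  then have "polygon_length \<gamma> p \<le> (\<Sum>i<k. ennreal (?d (\<lambda>i. min (t i) c) i) + ennreal (?d (\<lambda>i. max (t i) c) i))"
    unfolding polygon_length_def kt prod.case
    by (intro sum_mono) (simp add: ennreal_leI flip: ennreal_plus)
  also have "\<dots> = polygon_length \<gamma> (k, \<lambda>i. min (t i) c) + polygon_length \<gamma> (k, \<lambda>i. max (t i) c)"
    unfolding polygon_length_def prod.case by (rule sum.distrib)
  also have "\<dots> \<le> curve_length \<gamma> a c + curve_length \<gamma> c b"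
    using p assms unfolding kt by (intro add_mono curve_length_upper polygons_min polygons_max)
  finally show "polygon_length \<gamma> p \<le> curve_length \<gamma> a c + curve_length \<gamma> c b" .
qed

lemma curve_length_add:
  "a \<le> c \<Longrightarrow> c \<le> b \<Longrightarrow> curve_length \<gamma> a c + curve_length \<gamma> c b = curve_length \<gamma> a b"
  by (intro antisym curve_length_superadd curve_length_subadd)

section \<open>Continuity of the length in an end of the arc\<close>

lemma polygon_length_tendsto:
  assumes \<gamma>: "continuous_on {a..b} \<gamma>" and c: "c \<in> {a..b}"
    and w: "\<And>i. i \<le> k \<Longrightarrow> continuous_on {a..b} (w i)" "\<And>i s. i \<le> k \<Longrightarrow> s \<in> {a..b} \<Longrightarrow> w i s \<in> {a..b}"
  shows "((\<lambda>s. polygon_length \<gamma> (k, \<lambda>i. w i s)) \<longlongrightarrow> polygon_length \<gamma> (k, \<lambda>i. w i c)) (at c within {a..b})"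
proof -
  have "((\<lambda>s. \<gamma> (w i s)) \<longlongrightarrow> \<gamma> (w i c)) (at c within {a..b})" if "i \<le> k" for i
  proof -
    have "continuous_on {a..b} (\<lambda>s. \<gamma> (w i s))"
      by (rule continuous_on_compose2[OF \<gamma> w(1)[OF that]]) (use w(2)[OF that] in auto)
    then show ?thesis using c by (simp add: continuous_on)
  qed
  then show ?thesis
    unfolding polygon_length_def by (auto intro!: tendsto_sum tendsto_ennrealI tendsto_dist)
qed

text \<open>Both \<open>s \<mapsto> L(a,s)\<close> and \<open>s \<mapsto> L(s,b)\<close> are lower semicontinuous, and their sum is constant;
  hence both are continuous.\<close>

lemma curve_length_lsc_left:
  assumes \<gamma>: "continuous_on {a..b} \<gamma>" and c: "c \<in> {a..b}" and y: "y < curve_length \<gamma> a c"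
  shows "\<forall>\<^sub>F s in at c within {a..b}. y < curve_length \<gamma> a s"
proof -
  obtain k t where p: "(k, t) \<in> polygons a c" "y < polygon_length \<gamma> (k, t)"
    using y unfolding curve_length_eq less_SUP_iff by auto
  have t: "\<And>i. i \<le> k \<Longrightarrow> a \<le> t i \<and> t i \<le> c" using p(1) by (auto simp: polygons_def)
  \<comment> \<open>A fixed polygon longer than \<open>y\<close> is clamped at the moving end
    \<open>s\<close>: it stays inscribed in the arc over \<open>{a..s}\<close> and its length varies
    continuously, so it still exceeds \<open>y\<close> for \<open>s\<close> near
    \<open>c\<close>.\<close>
  have "((\<lambda>s. polygon_length \<gamma> (k, \<lambda>i. min (t i) s)) \<longlongrightarrow> polygon_length \<gamma> (k, \<lambda>i. min (t i) c)) (at c within {a..b})"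
    using t c by (intro polygon_length_tendsto \<gamma> c) (fastforce intro!: continuous_intros)+
  moreover have "polygon_length \<gamma> (k, \<lambda>i. min (t i) c) = polygon_length \<gamma> (k, t)"
    unfolding polygon_length_def prod.case using t by (intro sum.cong refl) (simp add: min_absorb1)
  ultimately have "\<forall>\<^sub>F s in at c within {a..b}. y < polygon_length \<gamma> (k, \<lambda>i. min (t i) s)"
    using p(2) by (intro order_tendstoD(1)) auto
  moreover have "\<forall>\<^sub>F s in at c within {a..b}. s \<in> {a..b}"
    by (simp add: eventually_at_filter)
  ultimately show ?thesis
  proof eventually_elim
    case (elim s)
    then have "polygon_length \<gamma> (k, \<lambda>i. min (t i) s) \<le> curve_length \<gamma> a s"
      by (intro curve_length_upper polygons_min[OF p(1)]) auto
    with elim show ?case by order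
  qed
qed

lemma curve_length_lsc_right:
  assumes \<gamma>: "continuous_on {a..b} \<gamma>" and c: "c \<in> {a..b}" and y: "y < curve_length \<gamma> c b"
  shows "\<forall>\<^sub>F s in at c within {a..b}. y < curve_length \<gamma> s b"
proof -
  obtain k t where p: "(k, t) \<in> polygons c b" "y < polygon_length \<gamma> (k, t)"
    using y unfolding curve_length_eq less_SUP_iff by auto
  have t: "\<And>i. i \<le> k \<Longrightarrow> c \<le> t i \<and> t i \<le> b" using p(1) by (auto simp: polygons_def)
  have "((\<lambda>s. polygon_length \<gamma> (k, \<lambda>i. max (t i) s)) \<longlongrightarrow> polygon_length \<gamma> (k, \<lambda>i. max (t i) c)) (at c within {a..b})"
    using t c by (intro polygon_length_tendsto \<gamma> c) (fastforce intro!: continuous_intros)+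
  moreover have "polygon_length \<gamma> (k, \<lambda>i. max (t i) c) = polygon_length \<gamma> (k, t)"
    unfolding polygon_length_def prod.case using t by (intro sum.cong refl) (simp add: max_absorb1)
  ultimately have "\<forall>\<^sub>F s in at c within {a..b}. y < polygon_length \<gamma> (k, \<lambda>i. max (t i) s)"
    using p(2) by (intro order_tendstoD(1)) auto
  moreover have "\<forall>\<^sub>F s in at c within {a..b}. s \<in> {a..b}"
    by (simp add: eventually_at_filter)
  ultimately show ?thesis
  proof eventually_elim
    case (elim s)
    then have "polygon_length \<gamma> (k, \<lambda>i. max (t i) s) \<le> curve_length \<gamma> s b"
      by (intro curve_length_upper polygons_max[OF p(1)]) auto
    with elim show ?case by order
  qed
qed

lemma continuous_on_curve_length:
  assumes \<gamma>: "continuous_on {a..b} \<gamma>" and fin: "curve_length \<gamma> a b < \<infinity>"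
  shows "continuous_on {a..b} (\<lambda>s. enn2real (curve_length \<gamma> a s))"
  unfolding continuous_on
proof
  fix c assume c: "c \<in> {a..b}"
  let ?l = "\<lambda>s. enn2real (curve_length \<gamma> a s)" and ?r = "\<lambda>s. enn2real (curve_length \<gamma> s b)"
  have fl: "curve_length \<gamma> a s < \<infinity>" and fr: "curve_length \<gamma> s b < \<infinity>" if "s \<in> {a..b}" for s
    using curve_length_mono[of a a s b \<gamma>] curve_length_mono[of a s b b \<gamma>] that fin by (auto intro: le_less_trans)
  have sum: "?l s + ?r s = enn2real (curve_length \<gamma> a b)" if "s \<in> {a..b}" for s
    using curve_length_add[of a s b \<gamma>] that fl[OF that] fr[OF that] by (simp flip: enn2real_plus)
  \<comment> \<open>\<open>ennreal y\<close> is 0 for negative \<open>y\<close>, so the translation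
    between real and extended inequalities treats \<open>y < 0\<close> apart.\<close>
  have real_less: "y < enn2real x \<longleftrightarrow> y < 0 \<or> ennreal y < x" if "x < \<infinity>" for x y
  proof (cases "y < 0")
    case True
    then show ?thesis by (meson enn2real_nonneg less_le_trans)
  next
    case False
    then show ?thesis using that by (cases x rule: ennreal_cases) (simp_all add: ennreal_less_iff)
  qed
  have mem: "\<forall>\<^sub>F s in at c within {a..b}. s \<in> {a..b}"
    by (simp add: eventually_at_filter)
  show "(?l \<longlongrightarrow> ?l c) (at c within {a..b})"
  proof (rule order_tendstoI)
    fix y assume "y < ?l c"
    then consider "y < 0" | "ennreal y < curve_length \<gamma> a c"
      using real_less[OF fl[OF c]] by blast
    then show "\<forall>\<^sub>F s in at c within {a..b}. y < ?l s"
    proof cases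
      case 1
      then show ?thesis by (intro always_eventually allI) (meson enn2real_nonneg less_le_trans)
    next
      case 2
      from curve_length_lsc_left[OF \<gamma> c this] mem show ?thesis
        by eventually_elim (use real_less[OF fl] in blast)
    qed
  next
    fix y assume "?l c < y"
    \<comment> \<open>An upper bound on the length up to \<open>s\<close> is a lower bound on the
      length from \<open>s\<close> on, because the two add up to a finite constant.\<close>
    then have "enn2real (curve_length \<gamma> a b) - y < ?r c" (is "?y < _") using sum[OF c] by simp
    then consider "?y < 0" | "ennreal ?y < curve_length \<gamma> c b"
      using real_less[OF fr[OF c]] by blast
    then have "\<forall>\<^sub>F s in at c within {a..b}. ?y < ?r s"
    proof cases
      case 1
      then show ?thesis by (intro always_eventually allI) (meson enn2real_nonneg less_le_trans)
    next
      case 2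
      from curve_length_lsc_right[OF \<gamma> c this] mem show ?thesis
        by eventually_elim (use real_less[OF fr] in blast)
    qed
    with mem show "\<forall>\<^sub>F s in at c within {a..b}. ?l s < y"
      by eventually_elim (use sum in force)
  qed
qed

lemma emeasure_interval_measure_curve_length_singleton:
  fixes \<gamma> :: "real \<Rightarrow> complex"
  assumes \<gamma>: "continuous_on {0..1} \<gamma>" and fin: "curve_length \<gamma> 0 1 < \<infinity>"
  shows "emeasure (interval_measure (\<lambda>s. enn2real (curve_length \<gamma> 0 (min s 1)))) {c} = 0"
proof -
  let ?\<phi> = "\<lambda>s. enn2real (curve_length \<gamma> 0 (min s 1))"
  have mono: "?\<phi> s \<le> ?\<phi> t" if "s \<le> t" for s t
    using that fin by (intro enn2real_mono curve_length_mono le_less_trans[OF curve_length_mono fin[simplified]]) auto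
  \<comment> \<open>The Stieltjes function lives on the whole line. It is constant beyond 1 because
    of \<open>min\<close>, and 0 before 0 because reversed ends give length 0; thus it is the length
    function on \<open>{0..1}\<close> composed with the retraction of the line onto that interval,
    and inherits its continuity.\<close>
  have eq: "enn2real (curve_length \<gamma> 0 (max 0 (min s 1))) = ?\<phi> s" for s
    using curve_length_degenerate[of "min s 1" 0 \<gamma>] curve_length_degenerate[of 0 0 \<gamma>] by (auto simp: max_def)
  have "continuous_on UNIV (\<lambda>s. enn2real (curve_length \<gamma> 0 (max 0 (min s 1))))"
    by (rule continuous_on_compose2[OF continuous_on_curve_length[OF \<gamma> fin]])
       (auto intro!: continuous_intros)
  then have "continuous_on UNIV ?\<phi>"
    by (rule continuous_on_eq) (rule eq)
  from emeasure_interval_measure_Icc[OF order_refl mono this, of c] show ?thesis by simp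
qed

lemma space_arclength_measure [simp]: "space (arclength_measure \<gamma>) = path_image \<gamma>"
  by (simp add: arclength_measure_def space_restrict_space)

lemma null_sets_arclength_singleton:
  assumes \<gamma>: "rectifiable_jordan \<gamma>" and z: "z \<in> path_image \<gamma>"
  shows "{z} \<in> null_sets (arclength_measure \<gamma>)"
proof -
  let ?I = "interval_measure (\<lambda>s. enn2real (curve_length \<gamma> 0 (min s 1)))"
  let ?S = "restrict_space borel (path_image \<gamma>)"
  have cont: "continuous_on {0..1} \<gamma>" and simple: "simple_path \<gamma>" and fin: "curve_length \<gamma> 0 1 < \<infinity>"
    using \<gamma> by (auto simp: rectifiable_jordan_def simple_path_def path_def)
  have "\<gamma> \<in> borel_measurable (restrict_space borel {0..1})"
    by (rule borel_measurable_continuous_on_restrict[OF cont])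
  then have "\<gamma> \<in> borel_measurable (restrict_space ?I {0..1})"
    by (simp cong: measurable_cong_sets restrict_space_sets_cong)
  then have meas: "\<gamma> \<in> restrict_space ?I {0..1} \<rightarrow>\<^sub>M ?S"
    by (intro measurable_restrict_space2) (auto simp: space_restrict_space path_image_def)
  obtain c where c: "c \<in> {0..1}" "z = \<gamma> c" using z by (auto simp: path_image_def)
  let ?A = "\<gamma> -` {z} \<inter> {0..1}"
  \<comment> \<open>The path is closed, so its base point has both 0 and 1 as parameters; every
    other point has only one.\<close>
  have "?A \<subseteq> {0, 1, c}"
    using simple c unfolding simple_path_def loop_free_def by fastforce
  then have "finite ?A" by (rule finite_subset) simp
  then have "(\<Union>s\<in>?A. {s}) \<in> null_sets ?I"
    using emeasure_interval_measure_curve_length_singleton[OF cont fin] by (intro null_sets_UN' countable_finite) (auto simp: null_sets_def)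
  then have "emeasure ?I ?A = 0" by (simp add: null_setsD1)
  moreover have zS: "{z} \<in> sets ?S"
    using z \<gamma> by (subst sets_restrict_space_iff)
      (auto simp: rectifiable_jordan_def simple_path_def closed_path_image)
  moreover have "\<gamma> -` {z} \<inter> space (restrict_space ?I {0..1}) = ?A"
    by (simp add: space_restrict_space)
  ultimately have "emeasure (distr (restrict_space ?I {0..1}) ?S \<gamma>) {z} = 0"
    using meas by (simp add: emeasure_distr emeasure_restrict_space)
  then show ?thesis
    unfolding arclength_measure_def using zS by (intro null_sets_completionI) (simp add: null_sets_def)
qed

lemma measurable_arclength_continuous:
  fixes F :: "complex \<Rightarrow> complex"
  assumes "continuous_on (path_image \<gamma>) F"
  shows "F \<in> borel_measurable (arclength_measure \<gamma>)"
  unfolding arclength_measure_def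
  by (rule measurable_completion) (simp add: borel_measurable_continuous_on_restrict assms)

subsection \<open>The planar case\<close>

text \<open>\<open>?q * cnj ?q\<close> is the real denominator \<open>D\<close> of the general
  formula, so extending the complex fraction by \<open>cnj ?q\<close> turns one formula into the
  other.\<close>

lemma complex_mobius_eq:
  assumes "w \<in> ball 0 1" "z \<in> cball 0 1"
  shows "complex_mobius w z = mobius w z"
proof -
  let ?q = "1 + z * cnj w"
  define D where "D = 1 + 2 * (w \<bullet> z) + (norm w)\<^sup>2 * (norm z)\<^sup>2"
  have D: "D > 0" unfolding D_def using assms by (intro mobius_denom_pos) auto
  have qq: "?q * cnj ?q = complex_of_real D"
    unfolding D_def by (simp add: complex_eq_iff inner_complex_def cmod_power2) (simp add: power2_eq_square algebra_simps)
  then have q: "cnj ?q \<noteq> 0" using D by (metis mult_zero_right of_real_eq_0_iff less_irrefl)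
  have "(z + w) * cnj ?q = (1 + 2 * (w \<bullet> z) + (norm z)\<^sup>2) *\<^sub>R w + (1 - (norm w)\<^sup>2) *\<^sub>R z"
    by (simp add: complex_eq_iff inner_complex_def cmod_power2) (simp add: power2_eq_square algebra_simps)
  moreover have "complex_mobius w z = (z + w) * cnj ?q / (?q * cnj ?q)"
    unfolding complex_mobius_def by (rule nonzero_mult_divide_mult_cancel_right[OF q, symmetric])
  moreover have "v / complex_of_real D = v /\<^sub>R D" for v
    by (simp add: scaleR_conv_of_real divide_inverse mult.commute)
  ultimately show ?thesis
    unfolding mobius_def D_def[symmetric] by (simp only: qq)
qed

lemma nu_eq: "g 0 = 0 \<Longrightarrow> nu g z = radial_field g z"
  by (simp add: nu_def radial_field_def cis_Arg sgn_eq scaleR_conv_of_real divide_inverse)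

lemma radial_field_id: "radial_field (\<lambda>r. r) y = y"
  by (simp add: radial_field_def)

theorem theorem9:
  fixes g :: "real \<Rightarrow> real"
  assumes "continuous_on {0..1} g" and "g 0 = 0"
  shows
    "(\<forall>\<mu> :: (real ^ 'n) set \<Rightarrow> ereal.
        let M = restrict_space borel (cball 0 1) in
        signed_measure M \<mu> \<longrightarrow>
        0 < \<mu> (cball 0 1) \<longrightarrow> \<mu> (cball 0 1) \<le> total_variation M \<mu> (cball 0 1) \<longrightarrow>
        total_variation M \<mu> (cball 0 1) < \<infinity> \<longrightarrow>
        g 1 > 0 \<longrightarrow> (\<forall>y\<in>sphere 0 1. \<mu> {y} < \<mu> (cball 0 1) / 2) \<longrightarrow>
        (\<exists>x\<in>ball 0 1. signed_integral M \<mu> (\<lambda>y. radial_field g (mobius x y)) = 0))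
   \<and> (CARD('n) \<ge> 2 \<longrightarrow> (\<forall>\<mu> :: (real ^ 'n) set \<Rightarrow> ereal.
        let M = restrict_space borel (sphere 0 1) in
        signed_measure M \<mu> \<longrightarrow>
        0 < \<mu> (sphere 0 1) \<longrightarrow> \<mu> (sphere 0 1) \<le> total_variation M \<mu> (sphere 0 1) \<longrightarrow>
        total_variation M \<mu> (sphere 0 1) < \<infinity> \<longrightarrow>
        (\<forall>y\<in>sphere 0 1. \<mu> {y} < \<mu> (sphere 0 1) / 2) \<longrightarrow>
        (\<exists>x\<in>ball 0 1. signed_integral M \<mu> (\<lambda>y. mobius x y) = 0) \<and>
        (\<forall>x\<in>ball 0 1. signed_integral M \<mu> (\<lambda>y. mobius x y) = 0 \<longleftrightarrow>
            signed_integral M (signed_pushforward M (mobius x) \<mu>) (\<lambda>y. y) = 0)))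
   \<and> (CARD('n) \<ge> 2 \<longrightarrow> (\<forall>f :: real ^ 'n \<Rightarrow> real.
        integrable sphere_measure f \<longrightarrow> (LINT y|sphere_measure. f y) \<noteq> 0 \<longrightarrow>
        (\<exists>x\<in>ball 0 1. (LINT y|sphere_measure. f y *\<^sub>R mobius x y) = 0)))
   \<and> (\<forall>(\<Omega> :: complex set) (f :: complex \<Rightarrow> real) (F :: complex \<Rightarrow> complex).
        open \<Omega> \<longrightarrow> connected \<Omega> \<longrightarrow> simply_connected \<Omega> \<longrightarrow>
        integrable (lebesgue_on \<Omega>) f \<longrightarrow> (LINT z|lebesgue_on \<Omega>. f z) \<noteq> 0 \<longrightarrow>
        continuous_on \<Omega> F \<longrightarrow> F ` \<Omega> \<subseteq> ball 0 1 \<longrightarrow> g 1 > 0 \<longrightarrow>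
        (\<exists>w\<in>ball 0 1.
           (LINT z|lebesgue_on \<Omega>. nu g (complex_mobius w (F z)) * of_real (f z)) = 0))
   \<and> (\<forall>(\<gamma> :: real \<Rightarrow> complex) (f :: complex \<Rightarrow> real) (F :: complex \<Rightarrow> complex).
        rectifiable_jordan \<gamma> \<longrightarrow>
        integrable (arclength_measure \<gamma>) f \<longrightarrow> (LINT z|arclength_measure \<gamma>. f z) \<noteq> 0 \<longrightarrow>
        (\<exists>F'. homeomorphism (path_image \<gamma>) (sphere 0 1) F F') \<longrightarrow>
        (\<exists>w\<in>ball 0 1.
           (LINT z|arclength_measure \<gamma>. complex_mobius w (F z) * of_real (f z)) = 0))"
  (is "(\<forall>\<mu>. ?A \<mu>) \<and> (_ \<longrightarrow> (\<forall>\<mu>. ?B \<mu>)) \<and> (_ \<longrightarrow> (\<forall>f. ?C f)) \<and> (\<forall>\<Omega> f F. ?D \<Omega> f F) \<and> (\<forall>\<gamma> f F. ?E \<gamma> f F)")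
proof -
  \<comment> \<open>Since \<open>radial_field (\<lambda>r. r)\<close> is the identity, this choice
    of \<open>g\<close> gives the statements on the sphere and on the Jordan curve, in which no
    radial profile occurs.\<close>
  have id: "continuous_on {0..1} (\<lambda>r::real. r)" "(\<lambda>r::real. r) 0 = 0" "(\<lambda>r::real. r) 1 > 0"
    by auto
  have A: "?A \<mu>" for \<mu>
    unfolding Let_def
    by (intro impI hersch_signed) (use assms in auto)
  have B: "?B \<mu>" for \<mu>
    unfolding Let_def
  proof (intro impI conjI ballI)
    let ?M = "restrict_space borel (sphere 0 1) :: (real ^ 'n) measure"
    assume \<mu>: "signed_measure ?M \<mu>" "0 < \<mu> (sphere 0 1)"
      "total_variation ?M \<mu> (sphere 0 1) < \<infinity>" "\<forall>y\<in>sphere 0 1. \<mu> {y} < \<mu> (sphere 0 1) / 2"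
    show "\<exists>x\<in>ball 0 1. signed_integral ?M \<mu> (\<lambda>y. mobius x y) = 0"
      using hersch_signed[where S = "sphere 0 1 :: (real ^ 'n) set" and g = "\<lambda>r. r", OF _ _ _ \<mu>(1,3,2) id] \<mu>(4)
      by (simp add: radial_field_id)
    fix x :: "real ^ 'n" assume x: "x \<in> ball 0 1"
    interpret finite_signed_measure ?M \<mu>
      by unfold_locales (use \<mu> in \<open>simp_all add: space_restrict_space\<close>)
    have "signed_integral ?M (signed_pushforward ?M (mobius x) \<mu>) (\<lambda>y. y) = signed_integral ?M \<mu> (\<lambda>y. mobius x y)"
    proof (rule signed_integral_pushforward)
      show "mobius x \<in> ?M \<rightarrow>\<^sub>M ?M"
        using mobius_in_sphere[OF x] by (intro measurable_restrict_space3) auto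
      show "(\<lambda>y. y) \<in> borel_measurable ?M"
        by (rule measurable_restrict_space1) simp
      fix B assume B: "B \<in> sets ?M"
      then have Bb: "B \<in> sets borel" "B \<subseteq> sphere 0 1"
        by (auto simp: sets_restrict_space_iff)
      \<comment> \<open>The witness is the image of \<open>B\<close> under \<open>mobius x\<close>,
        written as a preimage under the Borel inverse so that it is visibly measurable.\<close>
      let ?C = "mobius_sphere_inv x -` B \<inter> space borel \<inter> sphere 0 1"
      have "mobius_sphere_inv x -` B \<inter> space borel \<in> sets borel"
        by (rule measurable_sets[OF _ Bb(1)]) measurable
      then have "?C \<in> sets ?M" by (subst sets_restrict_space_iff) auto
      moreover have "B = mobius x -` ?C \<inter> space ?M"
        using Bb(2) mobius_sphere_inv[OF x] mobius_in_sphere[OF x]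
        by (auto simp: space_restrict_space)
      ultimately show "\<exists>C\<in>sets ?M. B = mobius x -` C \<inter> space ?M" by blast
    qed
    then show "signed_integral ?M \<mu> (\<lambda>y. mobius x y) = 0 \<longleftrightarrow>
        signed_integral ?M (signed_pushforward ?M (mobius x) \<mu>) (\<lambda>y. y) = 0" by simp
  qed
  have C: "?C f" if n: "CARD('n) \<ge> 2" for f
  proof (intro impI)
    assume f: "integrable sphere_measure f" "(LINT y|sphere_measure. f y) \<noteq> 0"
    have "{z \<in> space sphere_measure. z = y} \<in> null_sets sphere_measure" if y: "y \<in> sphere 0 1" for y :: "real ^ 'n"
    proof -
      have "{z \<in> space sphere_measure. z = y} = {y}" using y by auto
      then show ?thesis using null_sets_sphere_measure_singleton[OF y] n by simp
    qed
    from hersch_density[OF f measurable_ident_sphere_measure _ id this]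
    show "\<exists>x\<in>ball 0 1. (LINT y|sphere_measure. f y *\<^sub>R mobius x y) = 0"
      by (auto simp: radial_field_id)
  qed
  have D: "?D \<Omega> f F" for \<Omega> f F
  proof (intro impI)
    assume \<Omega>: "open \<Omega>" and f: "integrable (lebesgue_on \<Omega>) f" "(LINT z|lebesgue_on \<Omega>. f z) \<noteq> 0"
      and F: "continuous_on \<Omega> F" "F ` \<Omega> \<subseteq> ball 0 1" and g1: "g 1 > 0"
    have sp: "space (lebesgue_on \<Omega>) = \<Omega>" by (simp add: space_restrict_space)
    have "F \<in> borel_measurable (lebesgue_on \<Omega>)"
      using \<Omega> F(1) by (intro continuous_imp_measurable_on_sets_lebesgue) auto
    moreover have "F z \<in> cball 0 1" if "z \<in> space (lebesgue_on \<Omega>)" for z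
      using F(2) that sp by force
    moreover have "{z \<in> space (lebesgue_on \<Omega>). F z = y} \<in> null_sets (lebesgue_on \<Omega>)" if "y \<in> sphere 0 1" for y
    proof -
      have "{z \<in> space (lebesgue_on \<Omega>). F z = y} = {}" using F(2) that sp by force
      then show ?thesis by (simp only: null_sets.empty_sets)
    qed
    ultimately obtain w where w: "w \<in> ball 0 1"
      "(LINT z|lebesgue_on \<Omega>. f z *\<^sub>R radial_field g (mobius w (F z))) = 0"
      using hersch_density[OF f _ _ assms g1] by blast
    have "(LINT z|lebesgue_on \<Omega>. nu g (complex_mobius w (F z)) * of_real (f z))
        = (LINT z|lebesgue_on \<Omega>. f z *\<^sub>R radial_field g (mobius w (F z)))"
    proof (rule Bochner_Integration.integral_cong)
      fix z assume "z \<in> space (lebesgue_on \<Omega>)"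
      then have "F z \<in> cball 0 1" using F(2) sp by force
      then show "nu g (complex_mobius w (F z)) * of_real (f z) = f z *\<^sub>R radial_field g (mobius w (F z))"
        using w(1) assms(2) by (simp add: complex_mobius_eq nu_eq scaleR_conv_of_real mult.commute)
    qed simp
    with w show "\<exists>w\<in>ball 0 1. (LINT z|lebesgue_on \<Omega>. nu g (complex_mobius w (F z)) * of_real (f z)) = 0"
      by auto
  qed
  have E: "?E \<gamma> f F" for \<gamma> f F
  proof (intro impI)
    assume \<gamma>: "rectifiable_jordan \<gamma>"
      and f: "integrable (arclength_measure \<gamma>) f" "(LINT z|arclength_measure \<gamma>. f z) \<noteq> 0"
      and "\<exists>F'. homeomorphism (path_image \<gamma>) (sphere 0 1) F F'"
    then obtain F' where F: "homeomorphism (path_image \<gamma>) (sphere 0 1) F F'" by blast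
    have Fc: "F z \<in> cball 0 1" if "z \<in> space (arclength_measure \<gamma>)" for z
      using homeomorphism_image1[OF F] that sphere_cball[of 0 1] unfolding space_arclength_measure by blast
    have null: "{z \<in> space (arclength_measure \<gamma>). F z = y} \<in> null_sets (arclength_measure \<gamma>)"
      if y: "y \<in> sphere 0 1" for y
    proof -
      have "{z \<in> path_image \<gamma>. F z = y} = {F' y}" "F' y \<in> path_image \<gamma>"
        using F y unfolding homeomorphism_def by auto
      then show ?thesis using null_sets_arclength_singleton[OF \<gamma>] by simp
    qed
    have F_meas: "F \<in> borel_measurable (arclength_measure \<gamma>)"
      by (rule measurable_arclength_continuous[OF homeomorphism_cont1[OF F]])
    obtain w where w: "w \<in> ball 0 1"
      "(LINT z|arclength_measure \<gamma>. f z *\<^sub>R radial_field (\<lambda>r. r) (mobius w (F z))) = 0"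
      by (rule bexE[OF hersch_density[OF f F_meas Fc id null]])
    have "(LINT z|arclength_measure \<gamma>. complex_mobius w (F z) * of_real (f z))
        = (LINT z|arclength_measure \<gamma>. f z *\<^sub>R radial_field (\<lambda>r. r) (mobius w (F z)))"
      by (intro Bochner_Integration.integral_cong refl)
         (simp only: complex_mobius_eq[OF w(1) Fc] radial_field_id scaleR_conv_of_real mult.commute)
    with w show "\<exists>w\<in>ball 0 1. (LINT z|arclength_measure \<gamma>. complex_mobius w (F z) * of_real (f z)) = 0"
      by auto
  qed
  show ?thesis
    by (intro conjI allI impI[of "2 \<le> CARD('n)"]) (rule A B D E | erule C)+
qed

end
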